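(* Let $G$ be a group, $H\leqslant G$ a subgroup, $U$ a right $\mathbb{Z}H$-module, and $W=\operatorname{Coind}_H^G(U)$ the co-induced right $G$-module. Let $Y\subseteq G$ be a left transversal of $H$ in $G$ and let $\pi:G\to H$ be the projection along $Y$, i.e. $\pi(yh)=h$ for all $y\in Y$, $h\in H$. Let $n\geqslant 0$ and let $\Theta: H^n(G,W)\to H^n(H,U)$ be the Shapiro isomorphism. Then the inverse isomorphism $\Theta^{-1}: H^n(H,U)\to H^n(G,W)$ is induced from the map on inhomogeneous cocycles $Z^n(H,U)\to Z^n(G,W)$ given by $$ \beta\ \mapsto\ \big[(g_1,\ldots,g_n)\mapsto[\,g_{n+1}\mapsto \beta(h_1,\ldots,h_n)h_{n+1}\,]\big] $$ for every $\beta\in Z^n(H,U)$ and $g_1,\ldots,g_{n+1}\in G$, where the elements $h_1,\ldots,h_{n+1}\in H$ are uniquely determined from the relations $$ h_ih_{i+1}\cdots h_{n+1} = \pi (g_ig_{i+1}\cdots g_{n+1}),\qquad i=1,\ldots,n+1. $$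
   Context: All modules are right modules and all actions are right actions. Co-induced module: $W=\operatorname{Coind}_H^G(U)=\operatorname{Hom}_{\mathbb{Z}H}(\mathbb{Z}G,U)$ is the set $\{f:G\to U\mid f(gh)=f(g)h\ \ \forall g\in G,\ h\in H\}$ with pointwise addition and right $G$-action $(fa)(g)=f(ag)$ for $a,g\in G$. Inhomogeneous (normalised) cohomology: for a group $G$ and a right $G$-module $A$, $C^n(G,A)$ ($n\geqslant 0$) is the abelian group of all maps $\lambda:G^n\to A$ such that $\lambda(g_1,\ldots,g_n)=0$ whenever some $g_i=1$. The coboundary $\partial_{n-1}:C^{n-1}(G,A)\to C^n(G,A)$, $n\geqslant 1$, is $$ (\lambda\partial_{n-1})(g_1,\ldots,g_n) = (-1)^n\lambda(g_2,\ldots,g_n)+\sum_{i=1}^{n-1}(-1)^{n-i}\lambda(g_1,\ldots,g_{i-1},g_ig_{i+1},g_{i+2},\ldots,g_n)+\lambda(g_1,\ldots,g_{n-1})g_n , $$ and $\partial_{-1}$ is the zero map from $0$ to $C^0(G,A)$. Put $Z^n(G,A)=\operatorname{Ker}\partial_n$ ($n$-cocycles), $B^n(G,A)=\operatorname{Im}\partial_{n-1}$ ($n$-coboundaries), $H^n(G,A)=Z^n(G,A)/B^n(G,A)$. Shapiro isomorphism: $\Theta:H^n(G,W)\to H^n(H,U)$ is the isomorphism induced from the map on cocycles $\alpha\mapsto[(h_1,\ldots,h_n)\mapsto\alpha(h_1,\ldots,h_n)(1)]\in Z^n(H,U)$ for $\alpha\in Z^n(G,W)$, $h_1,\ldots,h_n\in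 H$. A left transversal $Y$ of $H$ in $G$ is a set of representatives of the cosets $gH$, so that every element of $G$ is uniquely $yh$ with $y\in Y$, $h\in H$; it is not assumed that $1\in Y$. *)

theory Defs
  imports "HOL-Algebra.Coset" "HOL-Algebra.FiniteProduct"
begin

(* Abelian groups are commutative groups in the sense of HOL-Algebra, hence written
   multiplicatively. A right module over the integral group ring of G is given as an abelian
   group A with a right action of G by endomorphisms. *)

locale right_gmodule = G?: group G + A?: comm_group A
  for G :: "('g, 'r) monoid_scheme" (structure)
    and A :: "('a, 's) monoid_scheme" (structure)
    and act :: "'a \<Rightarrow> 'g \<Rightarrow> 'a" +
  assumes act_closed: "\<lbrakk>a \<in> carrier A; g \<in> carrier G\<rbrakk> \<Longrightarrow> act a g \<in> carrier A"
    and act_one: "a \<in> carrier A \<Longrightarrow> act a \<one>\<^bsub>G\<^esub> = a"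
    and act_mult: "\<lbrakk>a \<in> carrier A; g \<in> carrier G; h \<in> carrier G\<rbrakk>
      \<Longrightarrow> act a (g \<otimes>\<^bsub>G\<^esub> h) = act (act a g) h"
    and act_add: "\<lbrakk>a \<in> carrier A; b \<in> carrier A; g \<in> carrier G\<rbrakk>
      \<Longrightarrow> act (a \<otimes>\<^bsub>A\<^esub> b) g = act a g \<otimes>\<^bsub>A\<^esub> act b g"

(* Elements of the n-th power of X are lists of length n. Functions on a carrier are taken
   extensional, so that equality of functions is equality on the carrier. *)

definition tuples :: "'a set \<Rightarrow> nat \<Rightarrow> 'a list set" where
  "tuples X n = {xs. length xs = n \<and> set xs \<subseteq> X}"

definition coind ::
  "('g, 'r) monoid_scheme \<Rightarrow> 'g set \<Rightarrow> ('u, 's) monoid_scheme \<Rightarrow> ('u \<Rightarrow> 'g \<Rightarrow> 'u)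
    \<Rightarrow> ('g \<Rightarrow> 'u) monoid" where
  "coind G H U act =
    \<lparr>carrier = {f \<in> carrier G \<rightarrow>\<^sub>E carrier U.
        \<forall>g\<in>carrier G. \<forall>h\<in>H. f (g \<otimes>\<^bsub>G\<^esub> h) = act (f g) h},
     mult = (\<lambda>f f'. \<lambda>g\<in>carrier G. f g \<otimes>\<^bsub>U\<^esub> f' g),
     one = (\<lambda>g\<in>carrier G. \<one>\<^bsub>U\<^esub>)\<rparr>"

definition coind_act :: "('g, 'r) monoid_scheme \<Rightarrow> ('g \<Rightarrow> 'u) \<Rightarrow> 'g \<Rightarrow> ('g \<Rightarrow> 'u)" where
  "coind_act G f a = (\<lambda>g\<in>carrier G. f (a \<otimes>\<^bsub>G\<^esub> g))"

definition cochains ::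
  "('g, 'r) monoid_scheme \<Rightarrow> ('a, 's) monoid_scheme \<Rightarrow> nat \<Rightarrow> ('g list \<Rightarrow> 'a) monoid" where
  "cochains G A n =
    \<lparr>carrier = {c \<in> tuples (carrier G) n \<rightarrow>\<^sub>E carrier A.
        \<forall>gs\<in>tuples (carrier G) n. \<one>\<^bsub>G\<^esub> \<in> set gs \<longrightarrow> c gs = \<one>\<^bsub>A\<^esub>},
     mult = (\<lambda>c c'. \<lambda>gs\<in>tuples (carrier G) n. c gs \<otimes>\<^bsub>A\<^esub> c' gs),
     one = (\<lambda>gs\<in>tuples (carrier G) n. \<one>\<^bsub>A\<^esub>)\<rparr>"

(* For 1 \<le> i < length gs, multiplies the i-th and (i+1)-st entries, counting from 1. *)

definition merge :: "('g, 'r) monoid_scheme \<Rightarrow> nat \<Rightarrow> 'g list \<Rightarrow> 'g list" where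
  "merge G i gs = take (i - 1) gs @ (gs ! (i - 1) \<otimes>\<^bsub>G\<^esub> gs ! i) # drop (i + 1) gs"

(* The coboundary from n-cochains to (n+1)-cochains. *)

definition coboundary ::
  "('g, 'r) monoid_scheme \<Rightarrow> ('a, 's) monoid_scheme \<Rightarrow> ('a \<Rightarrow> 'g \<Rightarrow> 'a) \<Rightarrow> nat
    \<Rightarrow> ('g list \<Rightarrow> 'a) \<Rightarrow> ('g list \<Rightarrow> 'a)" where
  "coboundary G A act n c =
    (\<lambda>gs\<in>tuples (carrier G) (n + 1).
       c (tl gs) [^]\<^bsub>A\<^esub> ((-1) ^ (n + 1) :: int)
       \<otimes>\<^bsub>A\<^esub> (\<Otimes>\<^bsub>A\<^esub>i\<in>{1..n}. c (merge G i gs) [^]\<^bsub>A\<^esub> ((-1) ^ (n + 1 - i) :: int))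
       \<otimes>\<^bsub>A\<^esub> act (c (butlast gs)) (last gs))"

definition cocycles ::
  "('g, 'r) monoid_scheme \<Rightarrow> ('a, 's) monoid_scheme \<Rightarrow> ('a \<Rightarrow> 'g \<Rightarrow> 'a) \<Rightarrow> nat
    \<Rightarrow> ('g list \<Rightarrow> 'a) set" where
  "cocycles G A act n = kernel (cochains G A n) (cochains G A (n + 1)) (coboundary G A act n)"

definition coboundaries ::
  "('g, 'r) monoid_scheme \<Rightarrow> ('a, 's) monoid_scheme \<Rightarrow> ('a \<Rightarrow> 'g \<Rightarrow> 'a) \<Rightarrow> nat
    \<Rightarrow> ('g list \<Rightarrow> 'a) set" where
  "coboundaries G A act n =
    (case n of 0 \<Rightarrow> {\<one>\<^bsub>cochains G A 0\<^esub>}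
     | Suc m \<Rightarrow> coboundary G A act m ` carrier (cochains G A m))"

definition cohomology ::
  "('g, 'r) monoid_scheme \<Rightarrow> ('a, 's) monoid_scheme \<Rightarrow> ('a \<Rightarrow> 'g \<Rightarrow> 'a) \<Rightarrow> nat
    \<Rightarrow> ('g list \<Rightarrow> 'a) set monoid" where
  "cohomology G A act n =
    ((cochains G A n)\<lparr>carrier := cocycles G A act n\<rparr>) Mod (coboundaries G A act n)"

definition cohom_class ::
  "('g, 'r) monoid_scheme \<Rightarrow> ('a, 's) monoid_scheme \<Rightarrow> ('a \<Rightarrow> 'g \<Rightarrow> 'a) \<Rightarrow> nat
    \<Rightarrow> ('g list \<Rightarrow> 'a) \<Rightarrow> ('g list \<Rightarrow> 'a) set" where
  "cohom_class G A act n z = coboundaries G A act n #>\<^bsub>cochains G A n\<^esub> z"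

definition induced_from ::
  "('g, 'r) monoid_scheme \<Rightarrow> ('a, 's) monoid_scheme \<Rightarrow> ('a \<Rightarrow> 'g \<Rightarrow> 'a)
    \<Rightarrow> ('k, 't) monoid_scheme \<Rightarrow> ('b, 'v) monoid_scheme \<Rightarrow> ('b \<Rightarrow> 'k \<Rightarrow> 'b) \<Rightarrow> nat
    \<Rightarrow> (('g list \<Rightarrow> 'a) set \<Rightarrow> ('k list \<Rightarrow> 'b) set)
    \<Rightarrow> (('g list \<Rightarrow> 'a) \<Rightarrow> ('k list \<Rightarrow> 'b)) \<Rightarrow> bool" where
  "induced_from G A actA K B actB n F \<phi> \<longleftrightarrow>
    \<phi> \<in> cocycles G A actA n \<rightarrow> cocycles K B actB n \<and>
    (\<forall>z\<in>cocycles G A actA n.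
       F (cohom_class G A actA n z) = cohom_class K B actB n (\<phi> z))"

definition shapiro_cocycle ::
  "('g, 'r) monoid_scheme \<Rightarrow> 'g set \<Rightarrow> nat \<Rightarrow> ('g list \<Rightarrow> 'g \<Rightarrow> 'u) \<Rightarrow> ('g list \<Rightarrow> 'u)" where
  "shapiro_cocycle G H n \<alpha> = (\<lambda>hs\<in>tuples H n. \<alpha> hs \<one>\<^bsub>G\<^esub>)"

(* The map on cosets induced by shapiro_cocycle, without choosing representatives: the image of
   a class X, multiplied by the coboundaries of the target, is the class of the image of any
   cocycle in X. *)

definition shapiro ::
  "('g, 'r) monoid_scheme \<Rightarrow> 'g set \<Rightarrow> ('u, 's) monoid_scheme \<Rightarrow> ('u \<Rightarrow> 'g \<Rightarrow> 'u) \<Rightarrow> nat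
    \<Rightarrow> ('g list \<Rightarrow> 'g \<Rightarrow> 'u) set \<Rightarrow> ('g list \<Rightarrow> 'u) set" where
  "shapiro G H U act n X =
    coboundaries (G\<lparr>carrier := H\<rparr>) U act n
      <#>\<^bsub>cochains (G\<lparr>carrier := H\<rparr>) U n\<^esub> (shapiro_cocycle G H n ` X)"

definition left_transversal :: "('g, 'r) monoid_scheme \<Rightarrow> 'g set \<Rightarrow> 'g set \<Rightarrow> bool" where
  "left_transversal G H Y \<longleftrightarrow>
    Y \<subseteq> carrier G \<and> (\<forall>g\<in>carrier G. \<exists>!y. y \<in> Y \<and> y \<in> g <#\<^bsub>G\<^esub> H)"

definition list_prod :: "('g, 'r) monoid_scheme \<Rightarrow> 'g list \<Rightarrow> 'g" where
  "list_prod G gs = foldr (\<otimes>\<^bsub>G\<^esub>) gs \<one>\<^bsub>G\<^esub>"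

(* All tails of hs have the product prescribed by \<pi> and the corresponding tail of gs. *)

definition tail_relations ::
  "('g, 'r) monoid_scheme \<Rightarrow> 'g set \<Rightarrow> ('g \<Rightarrow> 'g) \<Rightarrow> 'g list \<Rightarrow> 'g list \<Rightarrow> bool" where
  "tail_relations G H \<pi> gs hs \<longleftrightarrow>
    hs \<in> tuples H (length gs) \<and>
    (\<forall>i<length gs. list_prod G (drop i hs) = \<pi> (list_prod G (drop i gs)))"

definition shapiro_inv_cocycle ::
  "('g, 'r) monoid_scheme \<Rightarrow> 'g set \<Rightarrow> ('u \<Rightarrow> 'g \<Rightarrow> 'u) \<Rightarrow> ('g \<Rightarrow> 'g) \<Rightarrow> nat
    \<Rightarrow> ('g list \<Rightarrow> 'u) \<Rightarrow> ('g list \<Rightarrow> 'g \<Rightarrow> 'u)" where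
  "shapiro_inv_cocycle G H act \<pi> n \<beta> =
    (\<lambda>gs\<in>tuples (carrier G) n. \<lambda>g\<in>carrier G.
       let hs = (THE hs. tail_relations G H \<pi> (gs @ [g]) hs)
       in act (\<beta> (take n hs)) (hs ! n))"

end

theory Submission
  imports Defs
begin

text \<open>
  Writing \<open>x\<^sub>i = g\<^sub>i \<cdots> g\<^sub>n\<^sub>+\<^sub>1\<close>, a cochain \<open>\<alpha>\<close> of \<open>G\<close> with values in the coinduced module becomes the homogeneous
  \<open>H\<close>-equivariant function \<open>(x\<^sub>1, \<dots>, x\<^sub>n\<^sub>+\<^sub>1) \<mapsto> \<alpha>(g\<^sub>1, \<dots>, g\<^sub>n)(g\<^sub>n\<^sub>+\<^sub>1)\<close> on \<open>G\<close>, and a cochain of \<open>H\<close> with values in \<open>U\<close>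
  becomes such a function on \<open>H\<close>. In this picture the Shapiro map is restriction from \<open>G\<close> to \<open>H\<close> and
  its claimed inverse is composition with \<open>\<pi>\<close>. Both compositions are pullbacks along \<open>H\<close>-equivariant
  self-maps (on \<open>H\<close> the map \<open>\<pi>\<close> is left translation by \<open>\<pi> \<one>\<close>, which need not be the identity), and the
  prism operator \<open>F \<mapsto> \<Sum>\<plusminus>F(x\<^sub>1, \<dots>, x\<^sub>i, \<phi> x\<^sub>i, \<dots>, \<phi> x\<^sub>n)\<close> shows that such pullbacks act trivially on cohomology.
\<close>

section \<open>Alternating face maps and the prism operator\<close>

lemma not_distinct_adj_Cons: "\<not> distinct_adj xs \<Longrightarrow> \<not> distinct_adj (x # xs)"
  by (auto dest: distinct_adj_ConsD)

lemma (in group) cancel_mult_inv: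
  assumes "a \<in> carrier G" "b \<in> carrier G"
  shows "a \<otimes> (inv a \<otimes> b) = b" "inv a \<otimes> (a \<otimes> b) = b"
  using assms by (simp_all flip: m_assoc)

text \<open>Commutativity makes inversion an endomorphism, and likewise the powers in the next
  lemma; signs can then be pulled out of face sums and prisms by \<open>face_sum_hom\<close> and
  \<open>prism_hom\<close>.\<close>

lemma (in comm_group) inv_hom: "(\<lambda>x. inv x) \<in> hom G G"
  by (auto simp: hom_def inv_mult)

lemma (in comm_group) power_hom: "(\<lambda>x. x [^] (s :: int)) \<in> hom G G"
  by (auto simp: hom_def int_pow_distrib)

context
  fixes U :: "('u, 's) monoid_scheme" (structure)
begin

text \<open>The simplicial coboundary in multiplicative notation: the face omitting the k-th entry,
  counted from 0, has sign (-1)^k. Freezing the head inside the function makes the identities below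
  inductions on the list for arbitrary \<open>F\<close>.\<close>

primrec face_sum :: "('x list \<Rightarrow> 'u) \<Rightarrow> 'x list \<Rightarrow> 'u" where
  "face_sum F [] = \<one>"
| "face_sum F (x # xs) = F xs \<otimes> inv (face_sum (\<lambda>ys. F (x # ys)) xs)"

text \<open>Unfolds to the standard triangulation of a prism: the term that repeats x_i as \<phi>
  x_i, with i counted from 0, has sign (-1)^i.\<close>

primrec prism :: "('x \<Rightarrow> 'x) \<Rightarrow> ('x list \<Rightarrow> 'u) \<Rightarrow> 'x list \<Rightarrow> 'u" where
  "prism \<phi> F [] = \<one>"
| "prism \<phi> F (x # xs) =
     F (x # \<phi> x # map \<phi> xs) \<otimes> inv (prism \<phi> (\<lambda>ys. F (x # ys)) xs)"

end

context comm_group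
begin

abbreviation "D \<equiv> face_sum G"
abbreviation "P \<equiv> prism G"

section \<open>Algebra of the face sum\<close>

lemma face_sum_closed:
  assumes "set xs \<subseteq> X" "\<And>ys. set ys \<subseteq> X \<Longrightarrow> F ys \<in> carrier G"
  shows "D F xs \<in> carrier G"
  using assms by (induction xs arbitrary: F) auto

text \<open>Only faces of \<open>xs\<close> are evaluated, and these are one entry shorter; the
  length condition lets a function that is trivial on that length be replaced by the constant
  \<one>.\<close>

lemma face_sum_cong:
  assumes "set xs \<subseteq> X" "\<And>ys. set ys \<subseteq> X \<Longrightarrow> Suc (length ys) = length xs \<Longrightarrow> F ys = F' ys"
  shows "D F xs = D F' xs"
  using assms
proof (induction xs arbitrary: F F')
  case (Cons x xs)
  have "D (\<lambda>ys. F (x # ys)) xs = D (\<lambda>ys. F' (x # ys)) xs"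
    by (rule Cons.IH) (use Cons.prems in auto)
  with Cons.prems show ?case by auto
qed simp

lemma face_sum_one [simp]: "D (\<lambda>_. \<one>) xs = \<one>"
  by (induction xs) auto

lemma face_sum_map: "D F (map r xs) = D (\<lambda>ys. F (map r ys)) xs"
  by (induction xs arbitrary: F) auto

lemma face_sum_hom:
  assumes "t \<in> hom G G" "set xs \<subseteq> X" "\<And>ys. set ys \<subseteq> X \<Longrightarrow> F ys \<in> carrier G"
  shows "D (\<lambda>ys. t (F ys)) xs = t (D F xs)"
proof -
  interpret t: group_hom G G t
    using assms(1) by unfold_locales
  show ?thesis
    using assms(2,3)
  proof (induction xs arbitrary: F)
    case (Cons x xs)
    have "D (\<lambda>ys. F (x # ys)) xs \<in> carrier G"
      by (rule face_sum_closed[of _ X]) (use Cons.prems in auto)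
    moreover have "D (\<lambda>ys. t (F (x # ys))) xs = t (D (\<lambda>ys. F (x # ys)) xs)"
      by (rule Cons.IH) (use Cons.prems in auto)
    ultimately show ?case
      using Cons.prems by simp
  qed simp
qed

lemma face_sum_mult:
  assumes "set xs \<subseteq> X" "\<And>ys. set ys \<subseteq> X \<Longrightarrow> F ys \<in> carrier G"
    "\<And>ys. set ys \<subseteq> X \<Longrightarrow> F' ys \<in> carrier G"
  shows "D (\<lambda>ys. F ys \<otimes> F' ys) xs = D F xs \<otimes> D F' xs"
  using assms
proof (induction xs arbitrary: F F')
  case (Cons x xs)
  have "D (\<lambda>ys. F (x # ys)) xs \<in> carrier G" "D (\<lambda>ys. F' (x # ys)) xs \<in> carrier G"
    by (rule face_sum_closed[of _ X]; use Cons.prems in auto)+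
  moreover have "D (\<lambda>ys. F (x # ys) \<otimes> F' (x # ys)) xs
      = D (\<lambda>ys. F (x # ys)) xs \<otimes> D (\<lambda>ys. F' (x # ys)) xs"
    by (rule Cons.IH) (use Cons.prems in auto)
  ultimately show ?case
    using Cons.prems by (simp add: inv_mult m_ac)
qed simp

text \<open>An adjacent repetition survives in every face except the two that omit one of the equal
  entries; these two coincide and carry opposite signs.\<close>

lemma face_sum_degenerate:
  assumes "set xs \<subseteq> X" "\<And>ys. set ys \<subseteq> X \<Longrightarrow> F ys \<in> carrier G"
    "\<And>ys. set ys \<subseteq> X \<Longrightarrow> \<not> distinct_adj ys \<Longrightarrow> F ys = \<one>" "\<not> distinct_adj xs"
  shows "D F xs = \<one>"
  using assms
proof (induction xs arbitrary: F)
  case (Cons x xs)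
  then obtain y ys where xs: "xs = y # ys"
    by (cases xs) auto
  show ?case
  proof (cases "distinct_adj xs")
    case False
    then have "D (\<lambda>ys. F (x # ys)) xs = \<one>"
      by (intro Cons.IH) (use Cons.prems in \<open>auto simp: not_distinct_adj_Cons\<close>)
    moreover have "F xs = \<one>"
      using False Cons.prems by auto
    ultimately show ?thesis by simp
  next
    case True
    with Cons.prems xs have xy: "x = y"
      by (auto simp: distinct_adj_Cons)
    \<comment> \<open>Apart from the two cancelling faces, every face still begins with the repeated
      pair and is trivial.\<close>
    have "D (\<lambda>zs. F (x # x # zs)) ys = D (\<lambda>_. \<one>) ys"
      by (rule face_sum_cong[of _ X]) (use Cons.prems xs in auto)
    with xs xy Cons.prems show ?thesis by auto
  qed
qed simp

section \<open>Algebra of the prism operator\<close>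

lemma prism_closed:
  assumes "set xs \<subseteq> X" "\<phi> \<in> X \<rightarrow> X" "\<And>ys. set ys \<subseteq> X \<Longrightarrow> F ys \<in> carrier G"
  shows "P \<phi> F xs \<in> carrier G"
  using assms
proof (induction xs arbitrary: F)
  case (Cons x xs)
  have "P \<phi> (\<lambda>ys. F (x # ys)) xs \<in> carrier G"
    by (rule Cons.IH) (use Cons.prems in auto)
  moreover have "F (x # \<phi> x # map \<phi> xs) \<in> carrier G"
    by (rule Cons.prems) (use Cons.prems in auto)
  ultimately show ?case by simp
qed simp

lemma prism_cong:
  assumes "set xs \<subseteq> X" "\<phi> \<in> X \<rightarrow> X"
    "\<And>ys. set ys \<subseteq> X \<Longrightarrow> length ys = Suc (length xs) \<Longrightarrow> F ys = F' ys"
  shows "P \<phi> F xs = P \<phi> F' xs"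
  using assms
proof (induction xs arbitrary: F F')
  case (Cons x xs)
  have "P \<phi> (\<lambda>ys. F (x # ys)) xs = P \<phi> (\<lambda>ys. F' (x # ys)) xs"
    by (rule Cons.IH) (use Cons.prems in auto)
  moreover have "F (x # \<phi> x # map \<phi> xs) = F' (x # \<phi> x # map \<phi> xs)"
    by (rule Cons.prems) (use Cons.prems in auto)
  ultimately show ?case by simp
qed simp

lemma prism_one [simp]: "P \<phi> (\<lambda>_. \<one>) xs = \<one>"
  by (induction xs) auto

text \<open>Applied with \<open>r\<close> a right translation by an element of \<open>H\<close>,
  with which an equivariant \<phi> commutes.\<close>

lemma prism_map:
  assumes "set xs \<subseteq> X" "\<And>x. x \<in> X \<Longrightarrow> \<phi> (r x) = r (\<phi> x)"
  shows "P \<phi> F (map r xs) = P \<phi> (\<lambda>ys. F (map r ys)) xs"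
  using assms
proof (induction xs arbitrary: F)
  case (Cons x xs)
  have "map \<phi> (map r xs) = map r (map \<phi> xs)"
    using Cons.prems by auto
  with Cons show ?case by (simp del: map_map)
qed simp

lemma prism_hom:
  assumes "t \<in> hom G G" "set xs \<subseteq> X" "\<phi> \<in> X \<rightarrow> X" "\<And>ys. set ys \<subseteq> X \<Longrightarrow> F ys \<in> carrier G"
  shows "P \<phi> (\<lambda>ys. t (F ys)) xs = t (P \<phi> F xs)"
proof -
  interpret t: group_hom G G t
    using assms(1) by unfold_locales
  show ?thesis
    using assms(2-)
  proof (induction xs arbitrary: F)
    case (Cons x xs)
    have "P \<phi> (\<lambda>ys. F (x # ys)) xs \<in> carrier G"
      by (rule prism_closed[of _ X]) (use Cons.prems in auto)
    moreover have "P \<phi> (\<lambda>ys. t (F (x # ys))) xs = t (P \<phi> (\<lambda>ys. F (x # ys)) xs)"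
      by (rule Cons.IH) (use Cons.prems in auto)
    moreover have "F (x # \<phi> x # map \<phi> xs) \<in> carrier G"
      by (rule Cons.prems) (use Cons.prems in auto)
    ultimately show ?case by simp
  qed simp
qed

lemma prism_mult:
  assumes "set xs \<subseteq> X" "\<phi> \<in> X \<rightarrow> X" "\<And>ys. set ys \<subseteq> X \<Longrightarrow> F ys \<in> carrier G"
    "\<And>ys. set ys \<subseteq> X \<Longrightarrow> F' ys \<in> carrier G"
  shows "P \<phi> (\<lambda>ys. F ys \<otimes> F' ys) xs = P \<phi> F xs \<otimes> P \<phi> F' xs"
  using assms
proof (induction xs arbitrary: F F')
  case (Cons x xs)
  have "P \<phi> (\<lambda>ys. F (x # ys)) xs \<in> carrier G" "P \<phi> (\<lambda>ys. F' (x # ys)) xs \<in> carrier G"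
    by (rule prism_closed[of _ X]; use Cons.prems in auto)+
  moreover have "P \<phi> (\<lambda>ys. F (x # ys) \<otimes> F' (x # ys)) xs
      = P \<phi> (\<lambda>ys. F (x # ys)) xs \<otimes> P \<phi> (\<lambda>ys. F' (x # ys)) xs"
    by (rule Cons.IH) (use Cons.prems in auto)
  moreover have "F (x # \<phi> x # map \<phi> xs) \<in> carrier G" "F' (x # \<phi> x # map \<phi> xs) \<in> carrier G"
    using Cons.prems(1,2) by (auto intro!: Cons.prems(3,4) simp: Pi_iff subset_iff)
  ultimately show ?case
    by (simp add: inv_mult m_ac)
qed simp

text \<open>Each term of the prism by itself keeps an adjacent repetition, either among the
  untouched entries or among their images under \<phi>. The homotopy therefore stays within
  normalised cochains.\<close>

lemma prism_degenerate:
  assumes "set xs \<subseteq> X" "\<phi> \<in> X \<rightarrow> X" "\<And>ys. set ys \<subseteq> X \<Longrightarrow> F ys \<in> carrier G"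
    "\<And>ys. set ys \<subseteq> X \<Longrightarrow> \<not> distinct_adj ys \<Longrightarrow> F ys = \<one>" "\<not> distinct_adj xs"
  shows "P \<phi> F xs = \<one>"
  using assms
proof (induction xs arbitrary: F)
  case (Cons x xs)
  then obtain y ys where xs: "xs = y # ys"
    by (cases xs) auto
  have sub: "set (\<phi> x # map \<phi> xs) \<subseteq> X"
    using Cons.prems by auto
  show ?case
  proof (cases "distinct_adj xs")
    case False
    then have "\<not> distinct_adj (map \<phi> xs)"
      by (auto simp: distinct_adj_conv_nth)
    then have "F (x # \<phi> x # map \<phi> xs) = \<one>"
      by (intro Cons.prems) (use Cons.prems sub in \<open>auto simp: not_distinct_adj_Cons\<close>)
    moreover have "P \<phi> (\<lambda>ys. F (x # ys)) xs = \<one>"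
      by (intro Cons.IH) (use False Cons.prems in \<open>auto simp: not_distinct_adj_Cons\<close>)
    ultimately show ?thesis by simp
  next
    case True
    with Cons.prems xs have xy: "x = y"
      by (auto simp: distinct_adj_Cons)
    have "P \<phi> (\<lambda>zs. F (x # x # zs)) ys = P \<phi> (\<lambda>_. \<one>) ys"
      by (rule prism_cong[of _ X]) (use Cons.prems xs in auto)
    moreover have "F (x # \<phi> x # \<phi> x # map \<phi> ys) = \<one>" "F (x # x # \<phi> x # map \<phi> ys) = \<one>"
      by (rule Cons.prems; use sub Cons.prems xs xy in auto)+
    ultimately show ?thesis using xs xy by simp
  qed
qed simp

text \<open>The chain homotopy identity. When the head is peeled off, \<open>?d\<close> and
  \<open>?p\<close> occur in both summands with opposite signs; what is left is the identity for
  \<open>?Fx\<close> on the tail, and its term \<open>?b\<close> cancels against the one already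
  present.\<close>

lemma prism_homotopy:
  assumes "set xs \<subseteq> X" "\<phi> \<in> X \<rightarrow> X" "\<And>ys. set ys \<subseteq> X \<Longrightarrow> F ys \<in> carrier G"
  shows "P \<phi> (D F) xs \<otimes> D (P \<phi> F) xs = F (map \<phi> xs) \<otimes> inv (F xs)"
  using assms
proof (induction xs arbitrary: F)
  case (Cons x xs)
  let ?Fx = "\<lambda>ys. F (x # ys)"
  let ?a = "F (map \<phi> (x # xs))" and ?b = "F (x # map \<phi> xs)" and ?f = "F (x # xs)"
    and ?d = "D (\<lambda>ys. F (x # \<phi> x # ys)) (map \<phi> xs)" and ?p = "P \<phi> F xs"
    and ?pd = "P \<phi> (D ?Fx) xs" and ?dp = "D (P \<phi> ?Fx) xs"
  have X: "x \<in> X" "\<phi> x \<in> X" "set xs \<subseteq> X" "set (map \<phi> xs) \<subseteq> X"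
    using Cons.prems by auto
  have cl: "?a \<in> carrier G" "?b \<in> carrier G" "?f \<in> carrier G" "?p \<in> carrier G"
      "?pd \<in> carrier G" "?dp \<in> carrier G" "?d \<in> carrier G"
    using X Cons.prems by (auto intro!: Cons.prems(3) face_sum_closed[of _ X] prism_closed[of _ X])
  have clD: "D F ys \<in> carrier G" "D ?Fx ys \<in> carrier G" if "set ys \<subseteq> X" for ys
    using that X Cons.prems by (auto intro!: face_sum_closed[of _ X])
  have clP: "P \<phi> F ys \<in> carrier G" "P \<phi> ?Fx ys \<in> carrier G" if "set ys \<subseteq> X" for ys
    using that X Cons.prems by (auto intro!: prism_closed[of _ X])
  have IH: "?pd \<otimes> ?dp = ?b \<otimes> inv ?f"
    using Cons.IH[of ?Fx] Cons.prems X by simp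
  have "P \<phi> (\<lambda>ys. D F (x # ys)) xs = P \<phi> (\<lambda>ys. F ys \<otimes> inv (D ?Fx ys)) xs"
    by simp
  also have "\<dots> = ?p \<otimes> inv ?pd"
    using X clD Cons.prems prism_hom[OF inv_hom X(3), of \<phi> "D ?Fx"]
    by (subst prism_mult[of _ X]) auto
  finally have 1: "P \<phi> (D F) (x # xs) = (?a \<otimes> inv (?b \<otimes> inv ?d)) \<otimes> inv (?p \<otimes> inv ?pd)"
    by simp
  have "D (\<lambda>ys. P \<phi> F (x # ys)) xs
      = D (\<lambda>ys. F (x # \<phi> x # map \<phi> ys) \<otimes> inv (P \<phi> ?Fx ys)) xs"
    by simp
  also have "\<dots> = ?d \<otimes> inv ?dp"
    unfolding face_sum_map
    using X clP Cons.prems(2) face_sum_hom[OF inv_hom X(3), of "P \<phi> ?Fx"]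
    by (subst face_sum_mult[of _ X]) (auto intro!: Cons.prems(3) simp: Pi_iff subset_iff)
  finally have 2: "D (P \<phi> F) (x # xs) = ?p \<otimes> inv (?d \<otimes> inv ?dp)"
    by simp
  have "P \<phi> (D F) (x # xs) \<otimes> D (P \<phi> F) (x # xs) = ?a \<otimes> inv ?b \<otimes> (?pd \<otimes> ?dp)"
    unfolding 1 2 using cl by (simp add: inv_mult m_ac cancel_mult_inv)
  also have "\<dots> = ?a \<otimes> inv ?f"
    unfolding IH using cl by (simp add: m_assoc cancel_mult_inv)
  finally show ?case .
qed simp

end

text \<open>The factor (-1)^m turns the sign (-1)^k of the k-th face into (-1)^(m - k), so that
  omission of the last entry counts positively, as in \<open>coboundary\<close>.\<close>

lemma (in comm_group) face_sum_eq_finprod: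
  assumes "set xs \<subseteq> X" "\<And>ys. set ys \<subseteq> X \<Longrightarrow> F ys \<in> carrier G" "length xs = Suc m"
  shows "D F xs [^] ((-1) ^ m :: int)
       = (\<Otimes>k\<in>{..m}. F (take k xs @ drop (Suc k) xs) [^] ((-1) ^ (m - k) :: int))"
  using assms
proof (induction m arbitrary: xs F)
  case 0
  then show ?case by (auto simp: length_Suc_conv)
next
  case (Suc m)
  then obtain x xs' where xs: "xs = x # xs'" and len: "length xs' = Suc m"
    by (cases xs) auto
  let ?Fx = "\<lambda>ys. F (x # ys)"
  have X: "x \<in> X" "set xs' \<subseteq> X" using Suc.prems xs by auto
  have cl: "F ys \<in> carrier G" "?Fx ys \<in> carrier G" if "set ys \<subseteq> X" for ys
    using that X Suc.prems by auto
  have sub: "set (take k xs' @ drop l xs') \<subseteq> X" for k l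
    using X set_take_subset[of k xs'] set_drop_subset[of l xs'] by auto
  have D: "D ?Fx xs' \<in> carrier G"
    using X cl by (intro face_sum_closed[of _ X]) auto
  \<comment> \<open>\<open>finprod_Suc2\<close> splits off the factor k = 0, which omits the head,
    and shifts the other indices to the faces of the tail.\<close>
  have "(\<Otimes>k\<in>{..Suc m}. F (take k xs @ drop (Suc k) xs) [^] ((-1) ^ (Suc m - k) :: int))
      = (\<Otimes>k\<in>{..m}. ?Fx (take k xs' @ drop (Suc k) xs') [^] ((-1) ^ (m - k) :: int))
        \<otimes> F xs' [^] ((-1) ^ Suc m :: int)"
    unfolding xs
  proof (subst finprod_Suc2)
    show "(\<lambda>k. F (take k (x # xs') @ drop (Suc k) (x # xs')) [^] ((-1) ^ (Suc m - k) :: int))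
        \<in> {..Suc m} \<rightarrow> carrier G"
      using X set_take_subset[of _ "x # xs'"] set_drop_subset[of _ xs']
      by (fastforce intro!: int_pow_closed cl)
  qed simp
  also have "\<dots> = D ?Fx xs' [^] ((-1) ^ m :: int) \<otimes> F xs' [^] ((-1) ^ Suc m :: int)"
    using Suc.IH[OF X(2) cl(2) len] by simp
  also have "\<dots> = D F xs [^] ((-1) ^ Suc m :: int)"
    using D cl[OF X(2)] X
    by (simp add: xs int_pow_distrib int_pow_inv int_pow_neg inv_mult m_comm)
  finally show ?case ..
qed

section \<open>Consecutive quotients and tail products\<close>

text \<open>Inhomogeneous coordinates g_i = x_i x_{i+1}^{-1} of a homogeneous list. The last entry
  is not recorded; it becomes the point at which a value in the coinduced module is
  evaluated.\<close>

fun quotients :: "('g, 'r) monoid_scheme \<Rightarrow> 'g list \<Rightarrow> 'g list" where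
  "quotients K (x # y # zs) = x \<otimes>\<^bsub>K\<^esub> inv\<^bsub>K\<^esub> y # quotients K (y # zs)"
| "quotients K _ = []"

primrec tail_prods :: "('g, 'r) monoid_scheme \<Rightarrow> 'g list \<Rightarrow> 'g list" where
  "tail_prods K [] = []"
| "tail_prods K (g # gs) = list_prod K (g # gs) # tail_prods K gs"

lemma length_quotients [simp]: "length (quotients K xs) = length xs - 1"
  by (induction xs rule: induct_list012) auto

lemma length_tail_prods [simp]: "length (tail_prods K gs) = length gs"
  by (induction gs) auto

lemma tail_prods_eq_Nil_iff [simp]: "tail_prods K gs = [] \<longleftrightarrow> gs = []"
  by (cases gs) auto

lemma nth_tail_prods: "i < length gs \<Longrightarrow> tail_prods K gs ! i = list_prod K (drop i gs)"
  by (induction gs arbitrary: i) (auto simp: nth_Cons split: nat.splits)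

context group
begin

lemma list_prod_closed: "set gs \<subseteq> carrier G \<Longrightarrow> list_prod G gs \<in> carrier G"
  by (induction gs) (auto simp: list_prod_def)

lemma tail_prods_closed: "set gs \<subseteq> carrier G \<Longrightarrow> set (tail_prods G gs) \<subseteq> carrier G"
  by (induction gs) (auto simp: list_prod_closed)

lemma quotients_closed: "set xs \<subseteq> carrier G \<Longrightarrow> set (quotients G xs) \<subseteq> carrier G"
  by (induction xs rule: induct_list012) auto

lemma last_tail_prods:
  assumes "set gs \<subseteq> carrier G" "gs \<noteq> []"
  shows "last (tail_prods G gs) = last gs"
  using assms by (induction gs) (auto simp: list_prod_def)

lemma quotients_tail_prods:
  assumes "set gs \<subseteq> carrier G"
  shows "quotients G (tail_prods G gs) = butlast gs"
  using assms
proof (induction gs)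
  case (Cons g gs)
  have "list_prod G gs \<in> carrier G"
    using Cons.prems by (intro list_prod_closed) auto
  with Cons show ?case
    by (cases gs) (auto simp: list_prod_def m_assoc cancel_mult_inv)
qed simp

lemma list_prod_quotients:
  assumes "set xs \<subseteq> carrier G" "xs \<noteq> []"
  shows "list_prod G (quotients G xs @ [last xs]) = hd xs"
  using assms
  by (induction xs rule: induct_list012) (auto simp: list_prod_def m_assoc cancel_mult_inv)

text \<open>With \<open>quotients_tail_prods\<close> and \<open>last_tail_prods\<close> this makes
  the two coordinate systems equivalent: a nonempty list amounts to its quotients together with its
  last entry.\<close>

lemma tail_prods_quotients:
  assumes "set xs \<subseteq> carrier G" "xs \<noteq> []"
  shows "tail_prods G (quotients G xs @ [last xs]) = xs"
  using assms
proof (induction xs rule: induct_list012)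
  case (3 x y zs)
  show ?case
    using 3 list_prod_quotients[of "x # y # zs"] by simp
qed (auto simp: list_prod_def)

text \<open>The factor h cancels in x_i h (x_{i+1} h)^{-1}, so a right translation moves only the
  point of evaluation.\<close>

lemma quotients_map_mult_right:
  assumes "set xs \<subseteq> carrier G" "h \<in> carrier G"
  shows "quotients G (map (\<lambda>x. x \<otimes> h) xs) = quotients G xs"
  using assms
  by (induction xs rule: induct_list012)
    (auto simp: inv_mult_group m_assoc cancel_mult_inv)

lemma list_prod_mult_last:
  assumes "set gs \<subseteq> carrier G" "g \<in> carrier G" "h \<in> carrier G"
  shows "list_prod G (gs @ [g \<otimes> h]) = list_prod G (gs @ [g]) \<otimes> h"
  using assms
proof (induction gs)
  case (Cons a gs)
  then have "list_prod G (gs @ [g]) \<in> carrier G"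
    by (intro list_prod_closed) auto
  with Cons show ?case by (simp add: list_prod_def m_assoc)
qed (simp add: list_prod_def)

text \<open>Every tail product has the last factor at its right end.\<close>

lemma tail_prods_mult_last:
  assumes "set gs \<subseteq> carrier G" "g \<in> carrier G" "h \<in> carrier G"
  shows "tail_prods G (gs @ [g \<otimes> h]) = map (\<lambda>x. x \<otimes> h) (tail_prods G (gs @ [g]))"
  using assms
proof (induction gs)
  case (Cons a gs)
  then show ?case
    using list_prod_mult_last[of "a # gs" g h] by simp
qed (simp add: list_prod_def)

text \<open>An entry g_i = 1 forces x_i = x_{i+1}, so normalisation becomes triviality on lists with
  adjacent repetitions. The final \<open>g\<close> is kept apart because x_{n+1} has no
  successor.\<close>

lemma tail_prods_degenerate:
  assumes "set gs \<subseteq> carrier G" "g \<in> carrier G" "\<one> \<in> set gs"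
  shows "\<not> distinct_adj (tail_prods G (gs @ [g]))"
  using assms
proof (induction gs)
  case (Cons a gs)
  have "list_prod G (gs @ [g]) \<in> carrier G"
    by (rule list_prod_closed) (use Cons.prems in auto)
  with Cons show ?case
    by (cases gs) (auto simp: list_prod_def)
qed simp

lemma quotients_degenerate:
  assumes "set xs \<subseteq> carrier G" "\<not> distinct_adj xs"
  shows "\<one> \<in> set (quotients G xs)"
  using assms
  by (induction xs rule: induct_list012) auto

lemma quotients_butlast: "quotients K (butlast xs) = butlast (quotients K xs)"
proof (induction xs rule: induct_list012)
  case (3 x y zs)
  then show ?case by (cases zs) auto
qed auto

text \<open>For the last face: deleting the last entry moves the point of evaluation to the entry
  before it, and this formula is what turns the move into the action by the last quotient.\<close>

lemma last_quotients_mult: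
  assumes "set xs \<subseteq> carrier G" "length xs \<ge> 2"
  shows "last (quotients G xs) \<otimes> last xs = last (butlast xs)"
  using assms
proof (induction xs rule: induct_list012)
  case (3 x y zs)
  from 3 show ?case by (cases zs) (auto simp: m_assoc)
qed auto

text \<open>x_{k-1} x_{k+1}^{-1} = (x_{k-1} x_k^{-1}) (x_k x_{k+1}^{-1}). Entries of
  \<open>xs\<close> are counted from 0 and \<open>merge\<close> counts quotients from 1, so both
  sides carry the same \<open>k\<close>.\<close>

lemma quotients_omit:
  assumes "set xs \<subseteq> carrier G" "0 < k" "Suc k < length xs"
  shows "quotients G (take k xs @ drop (Suc k) xs) = merge G k (quotients G xs)"
  using assms
proof (induction k arbitrary: xs)
  case (Suc k)
  then obtain x y z zs where xs: "xs = x # y # z # zs"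
    by (auto simp: less_eq_Suc_le Suc_le_length_iff)
  show ?case
  proof (cases k)
    case 0
    have "x \<otimes> inv z = x \<otimes> inv y \<otimes> (y \<otimes> inv z)"
      using Suc.prems xs by (simp add: m_assoc cancel_mult_inv)
    with 0 xs show ?thesis by (simp add: merge_def)
  next
    case (Suc l)
    have "quotients G (take k (y # z # zs) @ drop (Suc k) (y # z # zs))
        = merge G k (quotients G (y # z # zs))"
      by (rule Suc.IH) (use Suc Suc.prems xs in auto)
    with Suc xs show ?thesis by (simp add: merge_def)
  qed
qed simp

end

section \<open>Quotients by subgroups of coboundaries\<close>

text \<open>Abstract form of the final argument: \<open>Z\<close> and \<open>B\<close> stand for
  cocycles and coboundaries, and \<open>f\<close>, \<open>g\<close> for cochain maps that are
  inverse to each other only up to coboundaries. \<open>F\<close> has the same representative-free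
  form as \<open>shapiro\<close>.\<close>

lemma coset_map_iso:
  fixes C :: "('a, 'm) monoid_scheme" and C' :: "('b, 'k) monoid_scheme"
  assumes "comm_group C" "comm_group C'"
    and "subgroup B C" "subgroup B' C'" "subgroup Z C" "Z' \<subseteq> carrier C'"
    and f: "f \<in> hom C C'" "f ` Z \<subseteq> Z'" "f ` B \<subseteq> B'"
    and g: "g \<in> hom C' C" "g ` Z' \<subseteq> Z" "g ` B' \<subseteq> B"
    and gf: "\<And>z. z \<in> Z \<Longrightarrow> \<exists>b\<in>B. g (f z) = b \<otimes>\<^bsub>C\<^esub> z"
    and fg: "\<And>w. w \<in> Z' \<Longrightarrow> \<exists>b\<in>B'. f (g w) = b \<otimes>\<^bsub>C'\<^esub> w"
  defines "F \<equiv> \<lambda>X. B' <#>\<^bsub>C'\<^esub> (f ` X)"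
  shows "F \<in> iso (C\<lparr>carrier := Z\<rparr> Mod B) (C'\<lparr>carrier := Z'\<rparr> Mod B')" (is "_ \<in> iso ?Q ?Q'")
    and "\<forall>z\<in>Z. F (B #>\<^bsub>C\<^esub> z) = B' #>\<^bsub>C'\<^esub> f z"
    and "\<forall>w\<in>Z'. inv_into (carrier (C\<lparr>carrier := Z\<rparr> Mod B)) F (B' #>\<^bsub>C'\<^esub> w) = B #>\<^bsub>C\<^esub> g w"
proof -
  interpret C: comm_group C by fact
  interpret C': comm_group C' by fact
  interpret B: subgroup B C by fact
  interpret B': subgroup B' C' by fact
  interpret Z: subgroup Z C by fact
  interpret f: group_hom C C' f using f(1) by unfold_locales
  interpret g: group_hom C' C g using g(1) by unfold_locales
  have Z: "z \<in> carrier C" if "z \<in> Z" for z using that by (rule Z.mem_carrier)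
  have Z': "w \<in> carrier C'" if "w \<in> Z'" for w using that assms by blast
  have NB: "B \<lhd> C" and NB': "B' \<lhd> C'"
    using C.normal_iff_subgroup C'.normal_iff_subgroup assms by blast+
  \<comment> \<open>Cosets and their products use only the multiplication, which restricting the
    carrier to \<open>Z\<close> leaves unchanged; both can be computed in \<open>C\<close>.\<close>
  have carQ: "carrier ?Q = (\<lambda>z. B #>\<^bsub>C\<^esub> z) ` Z" and carQ': "carrier ?Q' = (\<lambda>w. B' #>\<^bsub>C'\<^esub> w) ` Z'"
    by (auto simp: FactGroup_def RCOSETS_def r_coset_def)
  have multQ: "mult ?Q = set_mult C" and multQ': "mult ?Q' = set_mult C'"
    by (auto simp: FactGroup_def set_mult_def fun_eq_iff)
  \<comment> \<open>\<open>f\<close> sends the ambiguity in \<open>B\<close> into \<open>B'\<close>,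
    where multiplication by \<open>B'\<close> absorbs it.\<close>
  have F: "F (B #>\<^bsub>C\<^esub> z) = B' #>\<^bsub>C'\<^esub> f z" if "z \<in> Z" for z
  proof (intro equalityI subsetI)
    fix x assume "x \<in> F (B #>\<^bsub>C\<^esub> z)"
    then obtain b b' where *: "b \<in> B" "b' \<in> B'" "x = b' \<otimes>\<^bsub>C'\<^esub> f (b \<otimes>\<^bsub>C\<^esub> z)"
      by (auto simp: F_def set_mult_def r_coset_def)
    then have "x = (b' \<otimes>\<^bsub>C'\<^esub> f b) \<otimes>\<^bsub>C'\<^esub> f z" "b' \<otimes>\<^bsub>C'\<^esub> f b \<in> B'"
      using f(3) Z[OF that] by (auto simp: C'.m_assoc)
    then show "x \<in> B' #>\<^bsub>C'\<^esub> f z" by (auto simp: r_coset_def)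
  next
    fix x assume "x \<in> B' #>\<^bsub>C'\<^esub> f z"
    then obtain b' where "b' \<in> B'" "x = b' \<otimes>\<^bsub>C'\<^esub> f z" by (auto simp: r_coset_def)
    moreover have "z \<in> B #>\<^bsub>C\<^esub> z"
      using Z[OF that] by (simp add: C.rcos_self assms)
    ultimately show "x \<in> F (B #>\<^bsub>C\<^esub> z)"
      by (auto simp: F_def set_mult_def)
  qed
  have coset_gf: "B #>\<^bsub>C\<^esub> g (f z) = B #>\<^bsub>C\<^esub> z" if "z \<in> Z" for z
    using gf[OF that] Z[OF that] by (metis C.repr_independence assms(3) C.rcosI B.subset)
  have coset_fg: "B' #>\<^bsub>C'\<^esub> f (g w) = B' #>\<^bsub>C'\<^esub> w" if "w \<in> Z'" for w
    using fg[OF that] Z'[OF that] by (metis C'.repr_independence assms(4) C'.rcosI B'.subset)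
  \<comment> \<open>Applying \<open>g\<close> brings the relation back to the source, where
    \<open>g (f z)\<close> and \<open>z\<close> lie in the same coset.\<close>
  have inj: "B #>\<^bsub>C\<^esub> z1 = B #>\<^bsub>C\<^esub> z2"
    if z: "z1 \<in> Z" "z2 \<in> Z" and eq: "B' #>\<^bsub>C'\<^esub> f z1 = B' #>\<^bsub>C'\<^esub> f z2" for z1 z2
  proof -
    have "f z1 \<in> B' #>\<^bsub>C'\<^esub> f z1"
      using Z[OF z(1)] by (simp add: C'.rcos_self assms)
    then obtain b' where b': "b' \<in> B'" "f z1 = b' \<otimes>\<^bsub>C'\<^esub> f z2"
      unfolding eq by (auto simp: r_coset_def)
    then have "g (f z1) = g b' \<otimes>\<^bsub>C\<^esub> g (f z2)" "g b' \<in> B"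
      using Z z g(3) by auto
    then have "B #>\<^bsub>C\<^esub> g (f z1) = B #>\<^bsub>C\<^esub> g (f z2)"
      by (metis C.repr_independence assms(3) C.rcosI B.subset f.hom_closed g.hom_closed Z z(2))
    with coset_gf z show ?thesis by simp
  qed
  have "F \<in> hom ?Q ?Q'"
  proof (rule homI)
    fix X assume "X \<in> carrier ?Q"
    then show "F X \<in> carrier ?Q'"
      using F f(2) by (auto simp: carQ carQ')
  next
    fix X Y assume "X \<in> carrier ?Q" "Y \<in> carrier ?Q"
    then obtain x y where "x \<in> Z" "y \<in> Z" "X = B #>\<^bsub>C\<^esub> x" "Y = B #>\<^bsub>C\<^esub> y"
      by (auto simp: carQ)
    then show "F (X \<otimes>\<^bsub>?Q\<^esub> Y) = F X \<otimes>\<^bsub>?Q'\<^esub> F Y"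
      using Z by (simp add: multQ multQ' F normal.rcos_sum[OF NB] normal.rcos_sum[OF NB'])
  qed
  moreover have injF: "inj_on F (carrier ?Q)"
  proof (rule inj_onI)
    fix X Y assume XY: "X \<in> carrier ?Q" "Y \<in> carrier ?Q" and eq: "F X = F Y"
    then obtain x y where "x \<in> Z" "y \<in> Z" "X = B #>\<^bsub>C\<^esub> x" "Y = B #>\<^bsub>C\<^esub> y"
      by (auto simp: carQ)
    with inj eq F show "X = Y" by metis
  qed
  moreover have "F ` carrier ?Q = carrier ?Q'"
  proof -
    have "B' #>\<^bsub>C'\<^esub> w \<in> F ` carrier ?Q" if "w \<in> Z'" for w
      unfolding carQ using that g(2) F coset_fg
      by (metis imageI image_subset_iff)
    then show ?thesis
      using F f(2) by (auto simp: carQ carQ')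
  qed
  ultimately show "F \<in> iso ?Q ?Q'"
    by (simp add: iso_def bij_betw_def)
  show "\<forall>z\<in>Z. F (B #>\<^bsub>C\<^esub> z) = B' #>\<^bsub>C'\<^esub> f z"
    using F by blast
  show "\<forall>w\<in>Z'. inv_into (carrier ?Q) F (B' #>\<^bsub>C'\<^esub> w) = B #>\<^bsub>C\<^esub> g w"
  proof (intro ballI, rule inv_into_f_eq[OF injF])
    fix w assume w: "w \<in> Z'"
    show "B #>\<^bsub>C\<^esub> g w \<in> carrier ?Q"
      using w g(2) by (auto simp: carQ)
    show "F (B #>\<^bsub>C\<^esub> g w) = B' #>\<^bsub>C'\<^esub> w"
      using F coset_fg w g(2) by auto
  qed
qed

lemma hom_finprod:
  assumes "comm_group C" "comm_group U" "t \<in> hom C U" "f \<in> A \<rightarrow> carrier C"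
  shows "t (\<Otimes>\<^bsub>C\<^esub>i\<in>A. f i) = (\<Otimes>\<^bsub>U\<^esub>i\<in>A. t (f i))"
proof -
  interpret C: comm_group C by fact
  interpret U: comm_group U by fact
  interpret t: group_hom C U t using assms(3) by unfold_locales
  show ?thesis
    using assms(4) by (induction A rule: infinite_finite_induct) (auto simp: Pi_iff)
qed

section \<open>Cochain groups\<close>

lemma tuples_iff: "xs \<in> tuples X n \<longleftrightarrow> length xs = n \<and> set xs \<subseteq> X"
  by (simp add: tuples_def)

lemma cochains_simps:
  "\<alpha> \<in> carrier (cochains K M n) \<longleftrightarrow> \<alpha> \<in> tuples (carrier K) n \<rightarrow>\<^sub>E carrier M \<and>
     (\<forall>gs\<in>tuples (carrier K) n. \<one>\<^bsub>K\<^esub> \<in> set gs \<longrightarrow> \<alpha> gs = \<one>\<^bsub>M\<^esub>)"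
  "\<alpha> \<otimes>\<^bsub>cochains K M n\<^esub> \<beta> = (\<lambda>gs\<in>tuples (carrier K) n. \<alpha> gs \<otimes>\<^bsub>M\<^esub> \<beta> gs)"
  "\<one>\<^bsub>cochains K M n\<^esub> = (\<lambda>gs\<in>tuples (carrier K) n. \<one>\<^bsub>M\<^esub>)"
  by (auto simp: cochains_def)

lemma comm_group_cochains:
  assumes "comm_group M"
  shows "comm_group (cochains K M n)"
proof -
  interpret M: comm_group M by fact
  show ?thesis
  proof (rule comm_groupI)
    fix \<alpha> assume \<alpha>: "\<alpha> \<in> carrier (cochains K M n)"
    let ?\<beta> = "\<lambda>gs\<in>tuples (carrier K) n. inv\<^bsub>M\<^esub> \<alpha> gs"
    have "?\<beta> \<in> carrier (cochains K M n)" "?\<beta> \<otimes>\<^bsub>cochains K M n\<^esub> \<alpha> = \<one>\<^bsub>cochains K M n\<^esub>"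
      using \<alpha> by (auto simp: cochains_simps PiE_iff intro!: restrict_ext)
    then show "\<exists>\<beta>\<in>carrier (cochains K M n). \<beta> \<otimes>\<^bsub>cochains K M n\<^esub> \<alpha> = \<one>\<^bsub>cochains K M n\<^esub>"
      by blast
    show "\<one>\<^bsub>cochains K M n\<^esub> \<otimes>\<^bsub>cochains K M n\<^esub> \<alpha> = \<alpha>"
      using \<alpha> by (intro extensionalityI[of _ "tuples (carrier K) n"])
        (auto simp: cochains_simps PiE_iff)
  qed (auto simp: cochains_simps PiE_iff M.m_assoc intro!: restrict_ext intro: M.m_comm)
qed

section \<open>Homogeneous cochains of a coinduced module\<close>

text \<open>
  The module \<open>M\<close> over \<open>K\<close> is coinduced from the module \<open>U\<close> over \<open>H\<close>: through the family \<open>e\<close> of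
  homomorphisms its elements are the \<open>H\<close>-equivariant maps from \<open>K\<close> to \<open>U\<close>. Both the coinduced
  module over \<open>G\<close> and \<open>U\<close> itself, as a module over \<open>K = H\<close>, have this shape.
\<close>

locale coinduced_model =
  K: group K + M: comm_group M + U: comm_group U
  for K :: "('g, 'r) monoid_scheme" and M :: "('m, 't) monoid_scheme"
    and actM :: "'m \<Rightarrow> 'g \<Rightarrow> 'm" and H :: "'g set"
    and U :: "('u, 's) monoid_scheme" and act :: "'u \<Rightarrow> 'g \<Rightarrow> 'u"
    and e :: "'g \<Rightarrow> 'm \<Rightarrow> 'u" +
  assumes H_subset: "H \<subseteq> carrier K"
    and act_hom: "h \<in> H \<Longrightarrow> (\<lambda>u. act u h) \<in> hom U U"
    and actM_closed: "\<lbrakk>m \<in> carrier M; k \<in> carrier K\<rbrakk> \<Longrightarrow> actM m k \<in> carrier M"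
    and e_hom: "g \<in> carrier K \<Longrightarrow> e g \<in> hom M U"
    and e_actM: "\<lbrakk>m \<in> carrier M; g \<in> carrier K; k \<in> carrier K\<rbrakk> \<Longrightarrow> e g (actM m k) = e (k \<otimes>\<^bsub>K\<^esub> g) m"
    and e_equivariant:
      "\<lbrakk>m \<in> carrier M; g \<in> carrier K; h \<in> H\<rbrakk> \<Longrightarrow> e (g \<otimes>\<^bsub>K\<^esub> h) m = act (e g m) h"
    and e_inj: "\<lbrakk>m \<in> carrier M; m' \<in> carrier M; \<And>g. g \<in> carrier K \<Longrightarrow> e g m = e g m'\<rbrakk> \<Longrightarrow> m = m'"
    and e_surj: "\<lbrakk>f \<in> carrier K \<rightarrow> carrier U;
        \<And>g h. \<lbrakk>g \<in> carrier K; h \<in> H\<rbrakk> \<Longrightarrow> f (g \<otimes>\<^bsub>K\<^esub> h) = act (f g) h\<rbrakk>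
      \<Longrightarrow> \<exists>m\<in>carrier M. \<forall>g\<in>carrier K. e g m = f g"
begin

section \<open>Evaluation and action as homomorphisms\<close>

lemma e_closed: "\<lbrakk>g \<in> carrier K; m \<in> carrier M\<rbrakk> \<Longrightarrow> e g m \<in> carrier U"
  using e_hom by (auto simp: hom_def)

lemma e_mult:
  "\<lbrakk>g \<in> carrier K; m \<in> carrier M; m' \<in> carrier M\<rbrakk> \<Longrightarrow> e g (m \<otimes>\<^bsub>M\<^esub> m') = e g m \<otimes>\<^bsub>U\<^esub> e g m'"
  using e_hom by (auto simp: hom_def)

lemma e_one: "g \<in> carrier K \<Longrightarrow> e g \<one>\<^bsub>M\<^esub> = \<one>\<^bsub>U\<^esub>"
  by (intro hom_one e_hom M.is_group U.is_group)

lemma e_power: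
  "\<lbrakk>g \<in> carrier K; m \<in> carrier M\<rbrakk> \<Longrightarrow> e g (m [^]\<^bsub>M\<^esub> (k :: int)) = e g m [^]\<^bsub>U\<^esub> k"
  by (intro hom_int_pow e_hom M.is_group U.is_group)

lemma act_closed: "\<lbrakk>u \<in> carrier U; h \<in> H\<rbrakk> \<Longrightarrow> act u h \<in> carrier U"
  using act_hom by (auto simp: hom_def)

lemma act_one: "h \<in> H \<Longrightarrow> act \<one>\<^bsub>U\<^esub> h = \<one>\<^bsub>U\<^esub>"
  using hom_one[OF act_hom U.is_group U.is_group] .

text \<open>
  The value \<open>\<one>\<close> on lists of the wrong length lets the operators on lists act without length conditions.
\<close>

definition homogenise :: "nat \<Rightarrow> ('g list \<Rightarrow> 'm) \<Rightarrow> 'g list \<Rightarrow> 'u" where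
  "homogenise n \<alpha> xs =
    (if length xs = Suc n then e (last xs) (\<alpha> (quotients K xs)) else \<one>\<^bsub>U\<^esub>)"

text \<open>Describes the image of the normalised cochains under \<open>homogenise\<close>, as
  \<open>homogeneous_homogenise\<close> and \<open>homogenise_surj\<close> show; the
  \<open>distinct_adj\<close> condition is the normalisation. Values off lists over \<open>K\<close>
  are left free.\<close>

definition homogeneous :: "nat \<Rightarrow> ('g list \<Rightarrow> 'u) \<Rightarrow> bool" where
  "homogeneous n F \<longleftrightarrow> (\<forall>xs. set xs \<subseteq> carrier K \<longrightarrow>
     F xs \<in> carrier U \<and> (length xs \<noteq> Suc n \<longrightarrow> F xs = \<one>\<^bsub>U\<^esub>) \<and>
     (\<not> distinct_adj xs \<longrightarrow> F xs = \<one>\<^bsub>U\<^esub>) \<and>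
     (\<forall>h\<in>H. F (map (\<lambda>x. x \<otimes>\<^bsub>K\<^esub> h) xs) = act (F xs) h))"

lemma homogeneousD:
  assumes "homogeneous n F" "set xs \<subseteq> carrier K"
  shows "F xs \<in> carrier U" "length xs \<noteq> Suc n \<Longrightarrow> F xs = \<one>\<^bsub>U\<^esub>"
    "\<not> distinct_adj xs \<Longrightarrow> F xs = \<one>\<^bsub>U\<^esub>"
    "h \<in> H \<Longrightarrow> F (map (\<lambda>x. x \<otimes>\<^bsub>K\<^esub> h) xs) = act (F xs) h"
  using assms by (auto simp: homogeneous_def)

section \<open>Normalised cochains as homogeneous functions\<close>

lemma homogenise_closed:
  assumes "\<alpha> \<in> tuples (carrier K) n \<rightarrow> carrier M" "set xs \<subseteq> carrier K"
  shows "homogenise n \<alpha> xs \<in> carrier U"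
proof -
  have "last xs \<in> carrier K" if "length xs = Suc n"
    using assms(2) last_in_set[of xs] that by fastforce
  then show ?thesis
    using assms K.quotients_closed[OF assms(2)]
    by (auto simp: homogenise_def tuples_iff intro!: e_closed)
qed

lemma homogeneous_homogenise:
  assumes "\<alpha> \<in> carrier (cochains K M n)"
  shows "homogeneous n (homogenise n \<alpha>)"
  unfolding homogeneous_def
proof (intro allI impI conjI ballI)
  fix xs assume xs: "set xs \<subseteq> carrier K"
  have \<alpha>: "\<alpha> \<in> tuples (carrier K) n \<rightarrow> carrier M"
    using assms by (auto simp: cochains_simps)
  show "homogenise n \<alpha> xs \<in> carrier U"
    using \<alpha> xs by (rule homogenise_closed)
  show "homogenise n \<alpha> xs = \<one>\<^bsub>U\<^esub>" if "length xs \<noteq> Suc n"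
    using that by (simp add: homogenise_def)
  have Q: "quotients K xs \<in> tuples (carrier K) n" "last xs \<in> carrier K" if "length xs = Suc n"
  proof -
    from that have "xs \<noteq> []" by auto
    with that show "quotients K xs \<in> tuples (carrier K) n" "last xs \<in> carrier K"
      using xs K.quotients_closed[OF xs] last_in_set[of xs] by (auto simp: tuples_iff)
  qed
  show "homogenise n \<alpha> xs = \<one>\<^bsub>U\<^esub>" if "\<not> distinct_adj xs"
    using Q K.quotients_degenerate[OF xs that] assms
    by (auto simp: homogenise_def cochains_simps e_one)
  show "homogenise n \<alpha> (map (\<lambda>x. x \<otimes>\<^bsub>K\<^esub> h) xs) = act (homogenise n \<alpha> xs) h" if "h \<in> H" for h
  proof (cases "length xs = Suc n")
    case True
    then have "xs \<noteq> []" by auto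
    then show ?thesis
      using Q[OF True] True \<alpha> that H_subset xs
      by (auto simp: homogenise_def K.quotients_map_mult_right last_map subset_iff Pi_iff
          intro!: e_equivariant)
  qed (auto simp: homogenise_def act_one that)
qed

lemma homogenise_tail_prods:
  assumes "gs \<in> tuples (carrier K) n" "g \<in> carrier K"
  shows "homogenise n \<alpha> (tail_prods K (gs @ [g])) = e g (\<alpha> gs)"
  using assms K.last_tail_prods[of "gs @ [g]"] K.quotients_tail_prods[of "gs @ [g]"]
  by (auto simp: homogenise_def tuples_iff)

text \<open>The list \<open>tail_prods K (gs @ [g])\<close> reads off
  \<open>e g (\<alpha> gs)\<close>, and the maps \<open>e g\<close> are jointly injective.\<close>

lemma homogenise_inj:
  assumes "\<alpha> \<in> tuples (carrier K) n \<rightarrow>\<^sub>E carrier M" "\<beta> \<in> tuples (carrier K) n \<rightarrow>\<^sub>E carrier M"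
    and eq: "\<And>xs. set xs \<subseteq> carrier K \<Longrightarrow> homogenise n \<alpha> xs = homogenise n \<beta> xs"
  shows "\<alpha> = \<beta>"
proof (rule PiE_ext[OF assms(1,2)])
  fix gs assume gs: "gs \<in> tuples (carrier K) n"
  show "\<alpha> gs = \<beta> gs"
  proof (rule e_inj)
    fix g assume g: "g \<in> carrier K"
    then have "set (tail_prods K (gs @ [g])) \<subseteq> carrier K"
      using gs by (intro K.tail_prods_closed) (auto simp: tuples_iff)
    from eq[OF this] show "e g (\<alpha> gs) = e g (\<beta> gs)"
      by (simp add: homogenise_tail_prods gs g)
  qed (use assms gs in auto)
qed

text \<open>For fixed \<open>gs\<close>, the value of \<open>F\<close> at
  \<open>tail_prods K (gs @ [g])\<close> is an equivariant function of \<open>g\<close>, hence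
  represented by an element of \<open>M\<close> through \<open>e_surj\<close>; that element is the
  value of the cochain at \<open>gs\<close>.\<close>

lemma homogenise_surj:
  assumes F: "homogeneous n F"
  shows "\<exists>\<alpha>\<in>carrier (cochains K M n). \<forall>xs. set xs \<subseteq> carrier K \<longrightarrow> homogenise n \<alpha> xs = F xs"
proof -
  define \<alpha> where "\<alpha> = (\<lambda>gs\<in>tuples (carrier K) n.
    SOME m. m \<in> carrier M \<and> (\<forall>g\<in>carrier K. e g m = F (tail_prods K (gs @ [g]))))"
  have \<alpha>: "\<alpha> gs \<in> carrier M \<and> (\<forall>g\<in>carrier K. e g (\<alpha> gs) = F (tail_prods K (gs @ [g])))"
    if gs: "gs \<in> tuples (carrier K) n" for gs
  proof -
    have gs': "set gs \<subseteq> carrier K" using gs by (simp add: tuples_iff)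
    then have tp: "set (tail_prods K (gs @ [g])) \<subseteq> carrier K" if "g \<in> carrier K" for g
      using that by (intro K.tail_prods_closed) auto
    have "\<exists>m\<in>carrier M. \<forall>g\<in>carrier K. e g m = F (tail_prods K (gs @ [g]))"
    proof (rule e_surj)
      show "(\<lambda>g. F (tail_prods K (gs @ [g]))) \<in> carrier K \<rightarrow> carrier U"
        using homogeneousD(1)[OF F] tp by blast
      fix g h assume "g \<in> carrier K" "h \<in> H"
      then show "F (tail_prods K (gs @ [g \<otimes>\<^bsub>K\<^esub> h])) = act (F (tail_prods K (gs @ [g]))) h"
        using gs' tp H_subset homogeneousD(4)[OF F]
        by (subst K.tail_prods_mult_last) auto
    qed
    then show ?thesis
      unfolding \<alpha>_def restrict_apply'[OF gs] Bex_def by (rule someI_ex)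
  qed
  \<comment> \<open>A unit in \<open>gs\<close> produces an adjacent repetition among the tail
    products, where \<open>F\<close> is trivial.\<close>
  have "\<alpha> gs = \<one>\<^bsub>M\<^esub>" if gs: "gs \<in> tuples (carrier K) n" "\<one>\<^bsub>K\<^esub> \<in> set gs" for gs
  proof (rule e_inj)
    fix g assume g: "g \<in> carrier K"
    have "set (tail_prods K (gs @ [g])) \<subseteq> carrier K" "\<not> distinct_adj (tail_prods K (gs @ [g]))"
      using g gs K.tail_prods_closed[of "gs @ [g]"] K.tail_prods_degenerate[of gs g]
      by (auto simp: tuples_iff)
    then show "e g (\<alpha> gs) = e g \<one>\<^bsub>M\<^esub>"
      using \<alpha>[OF gs(1)] g homogeneousD(3)[OF F] by (simp add: e_one)
  qed (use \<alpha> gs in auto)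
  then have "\<alpha> \<in> carrier (cochains K M n)"
    using \<alpha> by (auto simp: cochains_simps \<alpha>_def)
  moreover have "homogenise n \<alpha> xs = F xs" if xs: "set xs \<subseteq> carrier K" for xs
  proof (cases "length xs = Suc n")
    case True
    then have ne: "xs \<noteq> []" by auto
    then have "quotients K xs \<in> tuples (carrier K) n" "last xs \<in> carrier K"
      using True xs K.quotients_closed[OF xs] last_in_set[OF ne] by (auto simp: tuples_iff)
    then show ?thesis
      using \<alpha> True K.tail_prods_quotients[OF xs ne] by (simp add: homogenise_def)
  next
    case False
    then show ?thesis
      using homogeneousD(2)[OF F xs] by (simp add: homogenise_def)
  qed
  ultimately show ?thesis by blast
qed

lemma homogenise_mult:
  assumes "\<alpha> \<in> carrier (cochains K M n)" "\<beta> \<in> carrier (cochains K M n)" "set xs \<subseteq> carrier K"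
  shows "homogenise n (\<alpha> \<otimes>\<^bsub>cochains K M n\<^esub> \<beta>) xs = homogenise n \<alpha> xs \<otimes>\<^bsub>U\<^esub> homogenise n \<beta> xs"
proof (cases "length xs = Suc n")
  case True
  then have "xs \<noteq> []" by auto
  then have "quotients K xs \<in> tuples (carrier K) n" "last xs \<in> carrier K"
    using True assms K.quotients_closed[OF assms(3)] last_in_set[of xs] by (auto simp: tuples_iff)
  then show ?thesis
    using True assms by (auto simp: homogenise_def cochains_simps PiE_iff e_mult)
qed (simp add: homogenise_def)

lemma homogenise_one: "set xs \<subseteq> carrier K \<Longrightarrow> homogenise n \<one>\<^bsub>cochains K M n\<^esub> xs = \<one>\<^bsub>U\<^esub>"
  using K.quotients_closed[of xs]
  by (cases xs rule: rev_cases) (auto simp: homogenise_def cochains_simps tuples_iff e_one)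

section \<open>The coboundary in homogeneous form\<close>

lemma coboundary_closed:
  assumes "\<alpha> \<in> tuples (carrier K) n \<rightarrow> carrier M"
  shows "coboundary K M actM n \<alpha> \<in> tuples (carrier K) (Suc n) \<rightarrow>\<^sub>E carrier M"
proof -
  have "merge K i gs \<in> tuples (carrier K) n"
    if "gs \<in> tuples (carrier K) (Suc n)" "i \<in> {1..n}" for gs i
    using that by (auto simp: merge_def tuples_iff subset_iff dest: in_set_takeD in_set_dropD)
  moreover have "tl gs \<in> tuples (carrier K) n" "butlast gs \<in> tuples (carrier K) n"
      "last gs \<in> carrier K" if "gs \<in> tuples (carrier K) (Suc n)" for gs
    using that by (cases gs; auto simp: tuples_iff dest: in_set_butlastD)+
  ultimately show ?thesis
    using assms
    by (auto simp: coboundary_def PiE_iff Pi_iff actM_closed intro!: M.m_closed M.finprod_closed)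
qed

text \<open>Let \<open>xs\<close> be x_0, ..., x_{n+1} with quotients g_1, ..., g_{n+1}. Omitting
  x_0 drops g_1, omitting an inner x_k merges g_k and g_{k+1}, and omitting x_{n+1} gives the
  summand with the action. The sign is that of \<open>face_sum_eq_finprod\<close> for m = n +
  1.\<close>

lemma homogenise_coboundary:
  assumes \<alpha>: "\<alpha> \<in> tuples (carrier K) n \<rightarrow> carrier M" and xs: "set xs \<subseteq> carrier K"
  shows "homogenise (Suc n) (coboundary K M actM n \<alpha>) xs
    = face_sum U (homogenise n \<alpha>) xs [^]\<^bsub>U\<^esub> ((-1) ^ Suc n :: int)"
proof (cases "length xs = Suc (Suc n)")
  case False
  \<comment> \<open>The faces have the wrong length too, so \<open>homogenise n \<alpha>\<close>
    takes its default value on each of them.\<close>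
  have "face_sum U (homogenise n \<alpha>) xs = face_sum U (\<lambda>_. \<one>\<^bsub>U\<^esub>) xs"
    by (rule U.face_sum_cong[OF xs]) (use False in \<open>auto simp: homogenise_def\<close>)
  with False show ?thesis by (simp add: homogenise_def)
next
  case len: True
  let ?gs = "quotients K xs" and ?l = "last xs"
  let ?t = "\<lambda>k. homogenise n \<alpha> (take k xs @ drop (Suc k) xs) [^]\<^bsub>U\<^esub> ((-1) ^ (Suc n - k) :: int)"
  have ne: "xs \<noteq> []" using len by auto
  have gs: "?gs \<in> tuples (carrier K) (Suc n)" and l: "?l \<in> carrier K"
    using len xs K.quotients_closed[OF xs] last_in_set[OF ne] by (auto simp: tuples_iff)
  have sub: "set (take k xs @ drop (Suc k) xs) \<subseteq> carrier K" for k
    using xs by (auto dest: in_set_takeD in_set_dropD)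
  have tcl: "?t k \<in> carrier U" for k
    using homogenise_closed[OF \<alpha> sub] by simp
  have faces: "merge K i ?gs \<in> tuples (carrier K) n" if "i \<in> {1..n}" for i
    using that gs by (auto simp: merge_def tuples_iff subset_iff dest: in_set_takeD in_set_dropD)
  have ends: "tl ?gs \<in> tuples (carrier K) n" "butlast ?gs \<in> tuples (carrier K) n"
      "last ?gs \<in> carrier K"
    using gs by (cases ?gs; auto simp: tuples_iff dest: in_set_butlastD)+
  have t0: "e ?l (\<alpha> (tl ?gs) [^]\<^bsub>M\<^esub> ((-1) ^ (n + 1) :: int)) = ?t 0"
  proof -
    obtain x y zs where "xs = x # y # zs"
      using len by (auto simp: length_Suc_conv)
    then show ?thesis
      using len \<alpha> ends l by (subst e_power) (auto simp: homogenise_def)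
  qed
  have ti: "e ?l (\<alpha> (merge K i ?gs) [^]\<^bsub>M\<^esub> ((-1) ^ (n + 1 - i) :: int)) = ?t i" if "i \<in> {1..n}" for i
  proof -
    have "last (take i xs @ drop (Suc i) xs) = ?l"
      using that len by simp
    moreover have "quotients K (take i xs @ drop (Suc i) xs) = merge K i ?gs"
      using that len xs by (intro K.quotients_omit) auto
    ultimately show ?thesis
      using that len \<alpha> faces[OF that] l by (subst e_power) (auto simp: homogenise_def)
  qed
  \<comment> \<open>The new last entry is \<open>last ?gs\<close> times the old one, so
    \<open>e_actM\<close> turns evaluation there into the action by \<open>last ?gs\<close>.\<close>
  have tn: "e ?l (actM (\<alpha> (butlast ?gs)) (last ?gs)) = ?t (Suc n)"
  proof -
    have "take (Suc n) xs @ drop (Suc (Suc n)) xs = butlast xs"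
      using len by (simp add: butlast_conv_take)
    then have "?t (Suc n) = e (last (butlast xs)) (\<alpha> (butlast ?gs))"
      using len l ends \<alpha> by (simp add: homogenise_def K.quotients_butlast e_closed Pi_iff
          K.last_quotients_mult[OF xs, symmetric])
    also have "\<dots> = e ?l (actM (\<alpha> (butlast ?gs)) (last ?gs))"
      using len l ends \<alpha> by (subst e_actM) (auto simp: K.last_quotients_mult[OF xs])
    finally show ?thesis ..
  qed
  have cl: "\<alpha> (tl ?gs) \<in> carrier M" "actM (\<alpha> (butlast ?gs)) (last ?gs) \<in> carrier M"
      "\<And>i. i \<in> {1..n} \<Longrightarrow> \<alpha> (merge K i ?gs) \<in> carrier M"
    using \<alpha> ends faces by (auto intro!: actM_closed)
  let ?m = "\<lambda>i. \<alpha> (merge K i ?gs) [^]\<^bsub>M\<^esub> ((-1) ^ (n + 1 - i) :: int)"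
  have fin: "(\<Otimes>\<^bsub>M\<^esub>i\<in>{1..n}. ?m i) \<in> carrier M"
    using cl by (intro M.finprod_closed) auto
  have "homogenise (Suc n) (coboundary K M actM n \<alpha>) xs
      = e ?l (\<alpha> (tl ?gs) [^]\<^bsub>M\<^esub> ((-1) ^ (n + 1) :: int)) \<otimes>\<^bsub>U\<^esub> e ?l (\<Otimes>\<^bsub>M\<^esub>i\<in>{1..n}. ?m i)
        \<otimes>\<^bsub>U\<^esub> e ?l (actM (\<alpha> (butlast ?gs)) (last ?gs))"
    using len gs cl fin l by (simp add: homogenise_def coboundary_def e_mult)
  also have "e ?l (\<Otimes>\<^bsub>M\<^esub>i\<in>{1..n}. ?m i) = (\<Otimes>\<^bsub>U\<^esub>i\<in>{1..n}. e ?l (?m i))"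
    using cl by (intro hom_finprod[OF M.comm_group_axioms U.comm_group_axioms e_hom[OF l]]) auto
  also have "\<dots> = (\<Otimes>\<^bsub>U\<^esub>i\<in>{1..n}. ?t i)"
    using tcl ti by (intro U.finprod_cong') auto
  also have "e ?l (\<alpha> (tl ?gs) [^]\<^bsub>M\<^esub> ((-1) ^ (n + 1) :: int)) \<otimes>\<^bsub>U\<^esub> (\<Otimes>\<^bsub>U\<^esub>i\<in>{1..n}. ?t i)
      = (\<Otimes>\<^bsub>U\<^esub>i\<in>{..n}. ?t i)"
  proof -
    have "{..n} = insert 0 {1..n}" by auto
    then show ?thesis
      unfolding t0 using tcl U.finprod_insert[of "{1..n}" 0 ?t, OF _ _ _ tcl] by (simp add: Pi_iff)
  qed
  also have "\<dots> \<otimes>\<^bsub>U\<^esub> e ?l (actM (\<alpha> (butlast ?gs)) (last ?gs)) = (\<Otimes>\<^bsub>U\<^esub>i\<in>{..Suc n}. ?t i)"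
    unfolding tn U.finprod_Suc[OF Pi_I, OF tcl]
    by (rule U.m_comm[OF U.finprod_closed[OF Pi_I] tcl]) (rule tcl)
  also have "\<dots> = face_sum U (homogenise n \<alpha>) xs [^]\<^bsub>U\<^esub> ((-1) ^ Suc n :: int)"
    using homogenise_closed[OF \<alpha>] len xs by (subst U.face_sum_eq_finprod[of _ "carrier K"]) auto
  finally show ?thesis .
qed


section \<open>Cocycles, coboundaries and the homotopy on cochains\<close>

abbreviation "cochain n \<equiv> cochains K M n"
abbreviation "\<delta> n \<equiv> coboundary K M actM n"

lemma sign_sign:
  assumes "u \<in> carrier U"
  shows "(u [^]\<^bsub>U\<^esub> ((-1) ^ k :: int)) [^]\<^bsub>U\<^esub> ((-1) ^ k :: int) = u"
  using assms by (simp add: U.int_pow_pow flip: power_mult_distrib)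

text \<open>Faces of a translated list are the translated faces, and
  \<open>face_sum_degenerate\<close> gives the normalisation. The exponent \<open>s\<close> makes
  room for the sign of \<open>homogenise_coboundary\<close>.\<close>

lemma homogeneous_face_sum:
  assumes F: "homogeneous n F"
  shows "homogeneous (Suc n) (\<lambda>xs. face_sum U F xs [^]\<^bsub>U\<^esub> (s :: int))"
proof -
  note cl = homogeneousD(1)[OF F]
  have Dcl: "face_sum U F xs \<in> carrier U" if "set xs \<subseteq> carrier K" for xs
    using that cl by (rule U.face_sum_closed)
  have "face_sum U F xs = \<one>\<^bsub>U\<^esub>" if "set xs \<subseteq> carrier K" "length xs \<noteq> Suc (Suc n)" for xs
    using U.face_sum_cong[OF that(1), of F "\<lambda>_. \<one>\<^bsub>U\<^esub>"] homogeneousD(2)[OF F] that(2) by auto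
  moreover have "face_sum U F xs = \<one>\<^bsub>U\<^esub>" if "set xs \<subseteq> carrier K" "\<not> distinct_adj xs" for xs
    using that(1) cl homogeneousD(3)[OF F] that(2) by (rule U.face_sum_degenerate)
  moreover have "face_sum U F (map (\<lambda>x. x \<otimes>\<^bsub>K\<^esub> h) xs) [^]\<^bsub>U\<^esub> s = act (face_sum U F xs [^]\<^bsub>U\<^esub> s) h"
    if "set xs \<subseteq> carrier K" "h \<in> H" for xs h
  proof -
    have "face_sum U F (map (\<lambda>x. x \<otimes>\<^bsub>K\<^esub> h) xs) = face_sum U (\<lambda>ys. act (F ys) h) xs"
      unfolding U.face_sum_map
      using that homogeneousD(4)[OF F] by (intro U.face_sum_cong[of _ "carrier K"]) auto
    also have "\<dots> = act (face_sum U F xs) h"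
      using act_hom[OF that(2)] that(1) cl by (rule U.face_sum_hom)
    finally show ?thesis
      using hom_int_pow[OF act_hom[OF that(2)] Dcl[OF that(1)] U.is_group U.is_group] by simp
  qed
  ultimately show ?thesis
    using Dcl by (auto simp: homogeneous_def)
qed

text \<open>Equivariance of \<phi> lets translations by \<open>H\<close> pass through the prism. The
  degree drops by one because \<open>prism\<close> evaluates \<open>F\<close> on lists one entry
  longer.\<close>

lemma homogeneous_prism:
  assumes F: "homogeneous (Suc n) F" and \<phi>: "\<phi> \<in> carrier K \<rightarrow> carrier K"
    "\<And>g h. \<lbrakk>g \<in> carrier K; h \<in> H\<rbrakk> \<Longrightarrow> \<phi> (g \<otimes>\<^bsub>K\<^esub> h) = \<phi> g \<otimes>\<^bsub>K\<^esub> h"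
  shows "homogeneous n (\<lambda>xs. prism U \<phi> F xs [^]\<^bsub>U\<^esub> (s :: int))"
proof -
  note cl = homogeneousD(1)[OF F]
  have Pcl: "prism U \<phi> F xs \<in> carrier U" if "set xs \<subseteq> carrier K" for xs
    using that \<phi>(1) cl by (rule U.prism_closed)
  have "prism U \<phi> F xs = \<one>\<^bsub>U\<^esub>" if "set xs \<subseteq> carrier K" "length xs \<noteq> Suc n" for xs
    using U.prism_cong[OF that(1) \<phi>(1), of F "\<lambda>_. \<one>\<^bsub>U\<^esub>"] homogeneousD(2)[OF F] that(2) by auto
  moreover have "prism U \<phi> F xs = \<one>\<^bsub>U\<^esub>" if "set xs \<subseteq> carrier K" "\<not> distinct_adj xs" for xs
    using that(1) \<phi>(1) cl homogeneousD(3)[OF F] that(2) by (rule U.prism_degenerate)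
  moreover have "prism U \<phi> F (map (\<lambda>x. x \<otimes>\<^bsub>K\<^esub> h) xs) [^]\<^bsub>U\<^esub> s = act (prism U \<phi> F xs [^]\<^bsub>U\<^esub> s) h"
    if "set xs \<subseteq> carrier K" "h \<in> H" for xs h
  proof -
    have "prism U \<phi> F (map (\<lambda>x. x \<otimes>\<^bsub>K\<^esub> h) xs) = prism U \<phi> (\<lambda>ys. F (map (\<lambda>x. x \<otimes>\<^bsub>K\<^esub> h) ys)) xs"
      using that \<phi>(2) by (intro U.prism_map[of _ "carrier K"]) auto
    also have "\<dots> = prism U \<phi> (\<lambda>ys. act (F ys) h) xs"
      using that homogeneousD(4)[OF F] by (intro U.prism_cong[OF _ \<phi>(1)]) auto
    also have "\<dots> = act (prism U \<phi> F xs) h"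
      using act_hom[OF that(2)] that(1) \<phi>(1) cl by (rule U.prism_hom)
    finally show ?thesis
      using hom_int_pow[OF act_hom[OF that(2)] Pcl[OF that(1)] U.is_group U.is_group] by simp
  qed
  ultimately show ?thesis
    using Pcl by (auto simp: homogeneous_def)
qed

lemma cochain_PiE: "\<alpha> \<in> carrier (cochain n) \<Longrightarrow> \<alpha> \<in> tuples (carrier K) n \<rightarrow>\<^sub>E carrier M"
  by (simp add: cochains_simps)

lemma cochain_Pi: "\<alpha> \<in> carrier (cochain n) \<Longrightarrow> \<alpha> \<in> tuples (carrier K) n \<rightarrow> carrier M"
  by (auto simp: cochains_simps)

lemma homogenise_cochain_closed:
  "\<lbrakk>\<alpha> \<in> carrier (cochain n); set xs \<subseteq> carrier K\<rbrakk> \<Longrightarrow> homogenise n \<alpha> xs \<in> carrier U"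
  by (intro homogenise_closed cochain_Pi)

lemma cochain_eqI:
  assumes "\<alpha> \<in> carrier (cochain n)" "\<beta> \<in> carrier (cochain n)"
    "\<And>xs. set xs \<subseteq> carrier K \<Longrightarrow> homogenise n \<alpha> xs = homogenise n \<beta> xs"
  shows "\<alpha> = \<beta>"
  using assms by (intro homogenise_inj[of \<alpha> n \<beta>] cochain_PiE)

text \<open>Normalisation is not checked on the inhomogeneous formula: the face sum is homogeneous,
  hence comes from a normalised cochain, and injectivity of \<open>homogenise\<close> identifies
  this cochain with the coboundary.\<close>

lemma coboundary_cochain:
  assumes "\<alpha> \<in> carrier (cochain n)"
  shows "\<delta> n \<alpha> \<in> carrier (cochain (Suc n))"
proof -
  obtain \<gamma> where \<gamma>: "\<gamma> \<in> carrier (cochain (Suc n))"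
      "\<And>xs. set xs \<subseteq> carrier K \<Longrightarrow>
        homogenise (Suc n) \<gamma> xs = face_sum U (homogenise n \<alpha>) xs [^]\<^bsub>U\<^esub> ((-1) ^ Suc n :: int)"
    using homogenise_surj[OF homogeneous_face_sum[OF homogeneous_homogenise[OF assms]]] by blast
  then have "\<delta> n \<alpha> = \<gamma>"
    using assms by (intro homogenise_inj[of _ "Suc n"] coboundary_closed cochain_Pi cochain_PiE)
      (simp_all add: homogenise_coboundary[OF cochain_Pi])
  with \<gamma> show ?thesis by simp
qed

lemma coboundary_hom: "\<delta> n \<in> hom (cochain n) (cochain (Suc n))"
proof (rule homI)
  interpret C: comm_group "cochain n"
    by (rule comm_group_cochains) (rule M.comm_group_axioms)
  interpret C': comm_group "cochain (Suc n)"
    by (rule comm_group_cochains) (rule M.comm_group_axioms)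
  fix \<alpha> \<beta> assume \<alpha>\<beta>: "\<alpha> \<in> carrier (cochain n)" "\<beta> \<in> carrier (cochain n)"
  note \<delta> = coboundary_cochain homogenise_coboundary[OF cochain_Pi]
  show "\<delta> n (\<alpha> \<otimes>\<^bsub>cochain n\<^esub> \<beta>) = \<delta> n \<alpha> \<otimes>\<^bsub>cochain (Suc n)\<^esub> \<delta> n \<beta>"
  proof (rule cochain_eqI)
    fix xs assume xs: "set xs \<subseteq> carrier K"
    have "face_sum U (homogenise n (\<alpha> \<otimes>\<^bsub>cochain n\<^esub> \<beta>)) xs
        = face_sum U (\<lambda>ys. homogenise n \<alpha> ys \<otimes>\<^bsub>U\<^esub> homogenise n \<beta> ys) xs"
      using \<alpha>\<beta> by (intro U.face_sum_cong[OF xs]) (simp add: homogenise_mult)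
    also have "\<dots> = face_sum U (homogenise n \<alpha>) xs \<otimes>\<^bsub>U\<^esub> face_sum U (homogenise n \<beta>) xs"
      using \<alpha>\<beta> by (intro U.face_sum_mult[OF xs] homogenise_cochain_closed)
    finally show "homogenise (Suc n) (\<delta> n (\<alpha> \<otimes>\<^bsub>cochain n\<^esub> \<beta>)) xs
        = homogenise (Suc n) (\<delta> n \<alpha> \<otimes>\<^bsub>cochain (Suc n)\<^esub> \<delta> n \<beta>) xs"
      using \<alpha>\<beta> xs U.face_sum_closed[OF xs homogenise_cochain_closed]
      by (simp add: homogenise_mult \<delta> U.int_pow_distrib del: power_Suc)
  qed (use \<alpha>\<beta> in \<open>auto intro: \<delta>\<close>)
qed (rule coboundary_cochain)

lemma cochain_group_hom: "group_hom (cochain n) (cochain (Suc n)) (\<delta> n)"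
  using coboundary_hom comm_group_cochains[OF M.comm_group_axioms]
  by (auto simp: group_hom_def group_hom_axioms_def comm_group_def)

lemma cocycles_subgroup: "subgroup (cocycles K M actM n) (cochain n)"
  unfolding cocycles_def using group_hom.subgroup_kernel[OF cochain_group_hom] by simp

lemma coboundaries_subgroup: "subgroup (coboundaries K M actM n) (cochain n)"
proof (cases n)
  case 0
  then show ?thesis
    using comm_group_cochains[OF M.comm_group_axioms, of K n]
    by (simp add: coboundaries_def comm_group_def group.triv_subgroup)
next
  case (Suc m)
  then show ?thesis
    using group_hom.img_is_subgroup[OF cochain_group_hom] by (simp add: coboundaries_def)
qed

lemma cocycles_iff:
  "\<alpha> \<in> cocycles K M actM n \<longleftrightarrow> \<alpha> \<in> carrier (cochain n) \<and> \<delta> n \<alpha> = \<one>\<^bsub>cochain (Suc n)\<^esub>"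
  by (simp add: cocycles_def kernel_def)

lemma face_sum_cocycle:
  assumes "\<alpha> \<in> cocycles K M actM n" "set xs \<subseteq> carrier K"
  shows "face_sum U (homogenise n \<alpha>) xs = \<one>\<^bsub>U\<^esub>"
proof -
  have \<alpha>: "\<alpha> \<in> carrier (cochain n)" and \<delta>\<alpha>: "\<delta> n \<alpha> = \<one>\<^bsub>cochain (Suc n)\<^esub>"
    using assms(1) by (auto simp: cocycles_iff)
  have "face_sum U (homogenise n \<alpha>) xs [^]\<^bsub>U\<^esub> ((-1) ^ Suc n :: int) = \<one>\<^bsub>U\<^esub>"
    using homogenise_coboundary[OF cochain_Pi[OF \<alpha>] assms(2)] assms(2) \<delta>\<alpha>
    by (simp add: homogenise_one)
  moreover have "face_sum U (homogenise n \<alpha>) xs \<in> carrier U"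
    using assms(2) \<alpha> by (intro U.face_sum_closed[of _ "carrier K"] homogenise_cochain_closed)
  ultimately show ?thesis
    using sign_sign by (metis U.int_pow_one)
qed

text \<open>On a cocycle the prism of the face sum in \<open>prism_homotopy\<close> disappears, so
  the pulled back function differs from the original by the face sum of a prism, which up to sign is
  a coboundary.\<close>

lemma pullback_cohomologous:
  assumes \<phi>: "\<phi> \<in> carrier K \<rightarrow> carrier K"
      "\<And>g h. \<lbrakk>g \<in> carrier K; h \<in> H\<rbrakk> \<Longrightarrow> \<phi> (g \<otimes>\<^bsub>K\<^esub> h) = \<phi> g \<otimes>\<^bsub>K\<^esub> h"
    and \<alpha>: "\<alpha> \<in> cocycles K M actM n" and \<beta>: "\<beta> \<in> carrier (cochain n)"
    and eq: "\<And>xs. set xs \<subseteq> carrier K \<Longrightarrow> homogenise n \<beta> xs = homogenise n \<alpha> (map \<phi> xs)"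
  shows "\<exists>b\<in>coboundaries K M actM n. \<beta> = b \<otimes>\<^bsub>cochain n\<^esub> \<alpha>"
proof -
  interpret C: comm_group "cochain n"
    by (rule comm_group_cochains) (rule M.comm_group_axioms)
  let ?F = "homogenise n \<alpha>"
  have \<alpha>C: "\<alpha> \<in> carrier (cochain n)"
    using \<alpha> by (simp add: cocycles_iff)
  note cl = homogenise_cochain_closed[OF \<alpha>C]
  have DP: "face_sum U (prism U \<phi> ?F) xs \<otimes>\<^bsub>U\<^esub> ?F xs = ?F (map \<phi> xs)"
    if xs: "set xs \<subseteq> carrier K" for xs
  proof -
    have "prism U \<phi> (face_sum U ?F) xs = prism U \<phi> (\<lambda>_. \<one>\<^bsub>U\<^esub>) xs"
      using face_sum_cocycle[OF \<alpha>] by (intro U.prism_cong[OF xs \<phi>(1)]) auto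
    moreover have "face_sum U (prism U \<phi> ?F) xs \<in> carrier U"
      by (intro U.face_sum_closed[OF xs] U.prism_closed[OF _ \<phi>(1)] cl)
    moreover have "?F (map \<phi> xs) \<in> carrier U"
      using xs \<phi>(1) by (intro cl) auto
    ultimately show ?thesis
      using U.prism_homotopy[OF xs \<phi>(1), of ?F] cl xs by (simp add: U.m_assoc)
  qed
  show ?thesis
  proof (cases n)
    case 0
    \<comment> \<open>In degree 0 the relevant lists are \<open>[x]\<close>, whose only face is
      empty and has trivial prism; the pullback leaves the cocycle unchanged.\<close>
    have "\<beta> = \<alpha>"
    proof (rule cochain_eqI[OF \<beta> \<alpha>C])
      fix xs assume xs: "set xs \<subseteq> carrier K"
      show "homogenise n \<beta> xs = homogenise n \<alpha> xs"
      proof (cases "\<exists>x. xs = [x]")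
        case True
        then show ?thesis using DP[OF xs] eq[OF xs] cl[OF xs] by auto
      next
        case False
        then have "length xs \<noteq> Suc n" using 0 by (auto simp: length_Suc_conv)
        then show ?thesis by (simp add: homogenise_def)
      qed
    qed
    then show ?thesis
      using 0 C.l_one[OF \<alpha>C] by (simp add: coboundaries_def)
  next
    case (Suc m)
    \<comment> \<open>Chosen to cancel the sign (-1)^(m + 1) that
      \<open>homogenise_coboundary\<close> contributes in degree m.\<close>
    let ?s = "(-1) ^ n :: int"
    let ?Q = "\<lambda>xs. prism U \<phi> ?F xs [^]\<^bsub>U\<^esub> ?s"
    obtain \<gamma> where \<gamma>: "\<gamma> \<in> carrier (cochain m)"
        "\<And>xs. set xs \<subseteq> carrier K \<Longrightarrow> homogenise m \<gamma> xs = ?Q xs"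
      using homogenise_surj[OF homogeneous_prism[OF homogeneous_homogenise[OF \<alpha>C[unfolded Suc]] \<phi>]]
      unfolding Suc by blast
    have \<delta>\<gamma>: "\<delta> m \<gamma> \<in> carrier (cochain n)"
      using coboundary_cochain[OF \<gamma>(1)] Suc by simp
    have "\<beta> = \<delta> m \<gamma> \<otimes>\<^bsub>cochain n\<^esub> \<alpha>"
    proof (rule cochain_eqI)
      fix xs assume xs: "set xs \<subseteq> carrier K"
      have Pcl: "prism U \<phi> ?F ys \<in> carrier U" if "set ys \<subseteq> carrier K" for ys
        using that \<phi>(1) cl by (rule U.prism_closed)
      have "face_sum U (homogenise m \<gamma>) xs = face_sum U ?Q xs"
        using \<gamma>(2) by (intro U.face_sum_cong[OF xs])
      also have "\<dots> = face_sum U (prism U \<phi> ?F) xs [^]\<^bsub>U\<^esub> ?s"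
        using U.power_hom xs Pcl by (rule U.face_sum_hom)
      finally have "homogenise n (\<delta> m \<gamma>) xs = face_sum U (prism U \<phi> ?F) xs"
        using homogenise_coboundary[OF cochain_Pi[OF \<gamma>(1)] xs] Suc
          sign_sign[OF U.face_sum_closed[OF xs Pcl], where k = n] by simp
      then show "homogenise n \<beta> xs = homogenise n (\<delta> m \<gamma> \<otimes>\<^bsub>cochain n\<^esub> \<alpha>) xs"
        using DP[OF xs] eq[OF xs] by (simp add: homogenise_mult \<delta>\<gamma> \<alpha>C xs)
    qed (use \<beta> \<delta>\<gamma> \<alpha>C in auto)
    then show ?thesis
      using \<gamma>(1) Suc by (auto simp: coboundaries_def)
  qed
qed

end

section \<open>Pulling back along an equivariant map\<close>

text \<open>Contravariant in \<phi>: a map from \<open>K\<close> to \<open>K'\<close> carries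
  cochains of \<open>T\<close> to cochains of \<open>S\<close>. All properties of \<open>f\<close>
  are derived from \<open>f_closed\<close> and \<open>f_eval\<close>. The instances are the
  inclusion of \<open>H\<close>, giving the Shapiro map, and \<pi>, giving its inverse.\<close>

locale coinduced_pullback =
  S: coinduced_model K M actM H U act e + T: coinduced_model K' M' actM' H U act e'
  for K :: "('g, 'r) monoid_scheme" and M :: "('m, 't) monoid_scheme"
    and actM :: "'m \<Rightarrow> 'g \<Rightarrow> 'm"
    and K' :: "('g, 'q) monoid_scheme" and M' :: "('k, 'v) monoid_scheme"
    and actM' :: "'k \<Rightarrow> 'g \<Rightarrow> 'k"
    and H :: "'g set" and U :: "('u, 's) monoid_scheme" and act :: "'u \<Rightarrow> 'g \<Rightarrow> 'u"
    and e :: "'g \<Rightarrow> 'm \<Rightarrow> 'u" and e' :: "'g \<Rightarrow> 'k \<Rightarrow> 'u" +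
  fixes \<phi> :: "'g \<Rightarrow> 'g" and f :: "nat \<Rightarrow> ('g list \<Rightarrow> 'k) \<Rightarrow> 'g list \<Rightarrow> 'm"
  assumes \<phi>_closed: "\<phi> \<in> carrier K \<rightarrow> carrier K'"
    and \<phi>_equivariant:
      "\<lbrakk>g \<in> carrier K; h \<in> H\<rbrakk> \<Longrightarrow> \<phi> (g \<otimes>\<^bsub>K\<^esub> h) = \<phi> g \<otimes>\<^bsub>K'\<^esub> h"
    and f_closed: "\<beta> \<in> carrier (T.cochain n) \<Longrightarrow> f n \<beta> \<in> tuples (carrier K) n \<rightarrow>\<^sub>E carrier M"
    and f_eval: "\<lbrakk>\<beta> \<in> carrier (T.cochain n); gs \<in> tuples (carrier K) n; g \<in> carrier K\<rbrakk>
      \<Longrightarrow> e g (f n \<beta> gs) = T.homogenise n \<beta> (map \<phi> (tail_prods K (gs @ [g])))"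
begin

lemma map_\<phi>_closed: "set xs \<subseteq> carrier K \<Longrightarrow> set (map \<phi> xs) \<subseteq> carrier K'"
  using \<phi>_closed by auto

lemma homogeneous_map:
  assumes F: "T.homogeneous n F"
  shows "S.homogeneous n (\<lambda>xs. F (map \<phi> xs))"
  unfolding S.homogeneous_def
proof (intro allI impI conjI ballI)
  fix xs assume xs: "set xs \<subseteq> carrier K"
  note F' = T.homogeneousD[OF F map_\<phi>_closed[OF xs]]
  show "F (map \<phi> xs) \<in> carrier U" by (rule F')
  show "F (map \<phi> xs) = \<one>\<^bsub>U\<^esub>" if "length xs \<noteq> Suc n" using F'(2) that by simp
  show "F (map \<phi> xs) = \<one>\<^bsub>U\<^esub>" if "\<not> distinct_adj xs"
    using that by (intro F'(3)) (auto simp: distinct_adj_conv_nth)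
  fix h assume h: "h \<in> H"
  have "map \<phi> (map (\<lambda>x. x \<otimes>\<^bsub>K\<^esub> h) xs) = map (\<lambda>x. x \<otimes>\<^bsub>K'\<^esub> h) (map \<phi> xs)"
    using xs h \<phi>_equivariant by auto
  then show "F (map \<phi> (map (\<lambda>x. x \<otimes>\<^bsub>K\<^esub> h) xs)) = act (F (map \<phi> xs)) h"
    using F'(4)[OF h] by (simp only:)
qed

text \<open>\<open>homogenise_surj\<close> supplies a normalised cochain with the pulled back
  homogeneous function; \<open>f_eval\<close> and \<open>e_inj\<close> identify it with
  \<open>f n \<beta>\<close>.\<close>

lemma f_cochain_homogenise:
  assumes \<beta>: "\<beta> \<in> carrier (T.cochain n)"
  shows "f n \<beta> \<in> carrier (S.cochain n) \<and>
    (\<forall>xs. set xs \<subseteq> carrier K \<longrightarrow> S.homogenise n (f n \<beta>) xs = T.homogenise n \<beta> (map \<phi> xs))"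
proof -
  obtain \<gamma> where \<gamma>: "\<gamma> \<in> carrier (S.cochain n)"
      "\<And>xs. set xs \<subseteq> carrier K \<Longrightarrow> S.homogenise n \<gamma> xs = T.homogenise n \<beta> (map \<phi> xs)"
    using S.homogenise_surj[OF homogeneous_map[OF T.homogeneous_homogenise[OF \<beta>]]] by blast
  have "f n \<beta> = \<gamma>"
  proof (rule PiE_ext[OF f_closed[OF \<beta>] S.cochain_PiE[OF \<gamma>(1)]])
    fix gs assume gs: "gs \<in> tuples (carrier K) n"
    show "f n \<beta> gs = \<gamma> gs"
    proof (rule S.e_inj)
      fix g assume g: "g \<in> carrier K"
      then have "set (tail_prods K (gs @ [g])) \<subseteq> carrier K"
        using gs by (intro S.K.tail_prods_closed) (auto simp: tuples_iff)
      then show "e g (f n \<beta> gs) = e g (\<gamma> gs)"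
        using f_eval[OF \<beta> gs g] \<gamma>(2) S.homogenise_tail_prods[OF gs g, of \<gamma>] by simp
    qed (use gs f_closed[OF \<beta>] S.cochain_PiE[OF \<gamma>(1)] in auto)
  qed
  with \<gamma> show ?thesis by simp
qed

lemma f_cochain: "\<beta> \<in> carrier (T.cochain n) \<Longrightarrow> f n \<beta> \<in> carrier (S.cochain n)"
  using f_cochain_homogenise by blast

lemma homogenise_f:
  "\<lbrakk>\<beta> \<in> carrier (T.cochain n); set xs \<subseteq> carrier K\<rbrakk>
    \<Longrightarrow> S.homogenise n (f n \<beta>) xs = T.homogenise n \<beta> (map \<phi> xs)"
  using f_cochain_homogenise by blast

lemma f_hom: "f n \<in> hom (T.cochain n) (S.cochain n)"
proof (rule homI)
  interpret C: comm_group "S.cochain n"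
    by (rule comm_group_cochains) (rule S.M.comm_group_axioms)
  interpret C': comm_group "T.cochain n"
    by (rule comm_group_cochains) (rule T.M.comm_group_axioms)
  fix \<alpha> \<beta> assume "\<alpha> \<in> carrier (T.cochain n)" "\<beta> \<in> carrier (T.cochain n)"
  then show "f n (\<alpha> \<otimes>\<^bsub>T.cochain n\<^esub> \<beta>) = f n \<alpha> \<otimes>\<^bsub>S.cochain n\<^esub> f n \<beta>"
    by (intro S.cochain_eqI[of _ n])
      (simp_all add: f_cochain homogenise_f S.homogenise_mult T.homogenise_mult
        map_\<phi>_closed[unfolded set_map])
qed (rule f_cochain)

text \<open>Face sums commute with mapping the entries through \<phi>, and the sign on either side
  depends only on \<open>n\<close>.\<close>

lemma f_coboundary:
  assumes \<beta>: "\<beta> \<in> carrier (T.cochain n)"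
  shows "f (Suc n) (T.\<delta> n \<beta>) = S.\<delta> n (f n \<beta>)"
proof (rule S.cochain_eqI)
  fix xs assume xs: "set xs \<subseteq> carrier K"
  have "face_sum U (T.homogenise n \<beta>) (map \<phi> xs) = face_sum U (S.homogenise n (f n \<beta>)) xs"
    unfolding S.U.face_sum_map
    using homogenise_f[OF \<beta>] by (intro S.U.face_sum_cong[OF xs]) simp
  then show "S.homogenise (Suc n) (f (Suc n) (T.\<delta> n \<beta>)) xs = S.homogenise (Suc n) (S.\<delta> n (f n \<beta>)) xs"
    using xs map_\<phi>_closed[OF xs]
    by (simp add: homogenise_f T.coboundary_cochain \<beta> f_cochain
        T.homogenise_coboundary[OF T.cochain_Pi[OF \<beta>]]
        S.homogenise_coboundary[OF S.cochain_Pi[OF f_cochain[OF \<beta>]]])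
qed (intro f_cochain T.coboundary_cochain S.coboundary_cochain \<beta>)+

lemma f_one: "f n \<one>\<^bsub>T.cochain n\<^esub> = \<one>\<^bsub>S.cochain n\<^esub>"
  using comm_group_cochains[OF S.M.comm_group_axioms] comm_group_cochains[OF T.M.comm_group_axioms]
  by (intro hom_one[OF f_hom]) (auto simp: comm_group_def)

lemma f_cocycles: "f n ` cocycles K' M' actM' n \<subseteq> cocycles K M actM n"
  by (auto simp: S.cocycles_iff T.cocycles_iff f_cochain f_one simp flip: f_coboundary)

lemma f_coboundaries: "f n ` coboundaries K' M' actM' n \<subseteq> coboundaries K M actM n"
proof (cases n)
  case 0
  then show ?thesis using f_one[of 0] by (simp add: coboundaries_def)
next
  case (Suc m)
  then show ?thesis by (auto simp: coboundaries_def f_coboundary f_cochain)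
qed

end

section \<open>The two models\<close>

lemma coind_simps:
  "w \<in> carrier (coind G H U act) \<longleftrightarrow> w \<in> carrier G \<rightarrow>\<^sub>E carrier U \<and>
     (\<forall>g\<in>carrier G. \<forall>h\<in>H. w (g \<otimes>\<^bsub>G\<^esub> h) = act (w g) h)"
  "w \<otimes>\<^bsub>coind G H U act\<^esub> w' = (\<lambda>g\<in>carrier G. w g \<otimes>\<^bsub>U\<^esub> w' g)"
  "\<one>\<^bsub>coind G H U act\<^esub> = (\<lambda>g\<in>carrier G. \<one>\<^bsub>U\<^esub>)"
  by (auto simp: coind_def)

locale shapiro_setup = G: group G + H: subgroup H G +
  M: right_gmodule "G\<lparr>carrier := H\<rparr>" U act
  for G :: "('g, 'r) monoid_scheme" and H :: "'g set"
    and U :: "('u, 's) monoid_scheme" and act :: "'u \<Rightarrow> 'g \<Rightarrow> 'u"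
begin

abbreviation "HG \<equiv> G\<lparr>carrier := H\<rparr>"
abbreviation "W \<equiv> coind G H U act"

lemma act_hom: "h \<in> H \<Longrightarrow> (\<lambda>u. act u h) \<in> hom U U"
  using M.act_closed M.act_add by (auto simp: hom_def)

lemma act_one: "h \<in> H \<Longrightarrow> act \<one>\<^bsub>U\<^esub> h = \<one>\<^bsub>U\<^esub>"
  using hom_one[OF act_hom M.A.is_group M.A.is_group] .

lemma act_inv: "\<lbrakk>h \<in> H; u \<in> carrier U\<rbrakk> \<Longrightarrow> act (inv\<^bsub>U\<^esub> u) h = inv\<^bsub>U\<^esub> act u h"
  using act_hom[of h] M.A.is_group
  by (intro group_hom.hom_inv) (auto simp: group_hom_def group_hom_axioms_def)

lemma comm_group_coind: "comm_group W"
proof (rule comm_groupI)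
  fix w assume w: "w \<in> carrier W"
  show "\<one>\<^bsub>W\<^esub> \<otimes>\<^bsub>W\<^esub> w = w"
    using w by (intro extensionalityI[of _ "carrier G"]) (auto simp: coind_simps PiE_iff)
  let ?v = "\<lambda>g\<in>carrier G. inv\<^bsub>U\<^esub> w g"
  have "?v \<in> carrier W" "?v \<otimes>\<^bsub>W\<^esub> w = \<one>\<^bsub>W\<^esub>"
    using w by (auto simp: coind_simps PiE_iff act_inv intro!: restrict_ext)
  then show "\<exists>v\<in>carrier W. v \<otimes>\<^bsub>W\<^esub> w = \<one>\<^bsub>W\<^esub>" by blast
qed (auto simp: coind_simps PiE_iff M.A.m_assoc act_one M.act_add[simplified] intro!: restrict_ext
    intro: M.A.m_comm)

text \<open>Elements of \<open>W\<close> already are equivariant functions, so \<open>e g\<close> is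
  evaluation at \<open>g\<close>.\<close>

sublocale big: coinduced_model G W "coind_act G" H U act "\<lambda>g w. w g"
proof (intro coinduced_model.intro coinduced_model_axioms.intro)
  show "group G" "comm_group W" "comm_group U"
    by (rule G.is_group comm_group_coind M.A.comm_group_axioms)+
  show "H \<subseteq> carrier G" by (rule H.subset)
  show "(\<lambda>u. act u h) \<in> hom U U" if "h \<in> H" for h using that by (rule act_hom)
  show "coind_act G w g \<in> carrier W" if "w \<in> carrier W" "g \<in> carrier G" for w g
    using that by (auto simp: coind_simps coind_act_def PiE_iff simp flip: G.m_assoc)
  fix w :: "'g \<Rightarrow> 'u" assume "w \<in> carrier W"
  moreover fix w' :: "'g \<Rightarrow> 'u" assume "w' \<in> carrier W" "\<And>g. g \<in> carrier G \<Longrightarrow> w g = w' g"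
  ultimately show "w = w'"
    by (intro extensionalityI[of w "carrier G"]) (auto simp: coind_simps PiE_iff)
next
  fix w assume w: "w \<in> carrier G \<rightarrow> carrier U"
    "\<And>g h. \<lbrakk>g \<in> carrier G; h \<in> H\<rbrakk> \<Longrightarrow> w (g \<otimes>\<^bsub>G\<^esub> h) = act (w g) h"
  then have "restrict w (carrier G) \<in> carrier W"
    by (auto simp: coind_simps)
  then show "\<exists>m\<in>carrier W. \<forall>g\<in>carrier G. m g = w g"
    by (rule bexI[rotated]) simp
qed (auto simp: coind_simps coind_act_def hom_def PiE_iff)

text \<open>\<open>U\<close> is coinduced from \<open>H\<close> to \<open>H\<close> itself:
  \<open>u\<close> corresponds to the function sending \<open>h\<close> to \<open>act u h\<close>,
  and is recovered as its value at \<one>.\<close>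

sublocale small: coinduced_model HG U act H U act "\<lambda>h u. act u h"
proof (intro coinduced_model.intro coinduced_model_axioms.intro)
  show "group HG" "comm_group U" "comm_group U"
    by (rule M.G.is_group M.A.comm_group_axioms)+
  fix u v assume "u \<in> carrier U" "v \<in> carrier U" "\<And>h. h \<in> carrier HG \<Longrightarrow> act u h = act v h"
  then show "u = v"
    using M.act_one by (metis M.G.one_closed)
next
  fix w assume w: "w \<in> carrier HG \<rightarrow> carrier U"
    "\<And>g h. \<lbrakk>g \<in> carrier HG; h \<in> H\<rbrakk> \<Longrightarrow> w (g \<otimes>\<^bsub>HG\<^esub> h) = act (w g) h"
  have "act (w \<one>\<^bsub>G\<^esub>) h = w h" if "h \<in> H" for h
    using w(2)[of "\<one>\<^bsub>G\<^esub>" h] that by simp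
  then show "\<exists>u\<in>carrier U. \<forall>h\<in>carrier HG. act u h = w h"
    using w(1) by (intro bexI[of _ "w \<one>\<^bsub>G\<^esub>"]) auto
qed (use act_hom M.act_mult M.act_closed in auto)

lemma tail_prods_HG: "tail_prods HG hs = tail_prods G hs"
  by (induction hs) (auto simp: list_prod_def)

text \<open>The Shapiro map as pullback along the inclusion of \<open>H\<close>. It records values
  at \<one> only; equivariance recovers those at the other elements of \<open>H\<close>.\<close>

sublocale restriction: coinduced_pullback HG U act G W "coind_act G" H U act
  "\<lambda>h u. act u h" "\<lambda>g w. w g" "\<lambda>x. x" "shapiro_cocycle G H"
proof unfold_locales
  fix n \<alpha> assume \<alpha>: "\<alpha> \<in> carrier (cochains G W n)"
  have sub: "gs \<in> tuples (carrier G) n" if "gs \<in> tuples H n" for gs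
    using that H.subset by (auto simp: tuples_iff)
  have W: "\<alpha> gs \<in> carrier W" if "gs \<in> tuples H n" for gs
    using sub[OF that] \<alpha> by (auto simp: cochains_simps)
  then show "shapiro_cocycle G H n \<alpha> \<in> tuples (carrier HG) n \<rightarrow>\<^sub>E carrier U"
    by (auto simp: shapiro_cocycle_def coind_simps PiE_iff)
  fix gs g assume gs: "gs \<in> tuples (carrier HG) n" and g: "g \<in> carrier HG"
  have "act (\<alpha> gs \<one>\<^bsub>G\<^esub>) g = \<alpha> gs (\<one>\<^bsub>G\<^esub> \<otimes>\<^bsub>G\<^esub> g)"
  proof -
    have "\<forall>g\<in>carrier G. \<forall>h\<in>H. \<alpha> gs (g \<otimes>\<^bsub>G\<^esub> h) = act (\<alpha> gs g) h"
      using W[of gs] gs by (simp add: coind_simps)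
    from bspec[OF bspec[OF this G.one_closed], of g] g show ?thesis by simp
  qed
  then show "act (shapiro_cocycle G H n \<alpha> gs) g
      = big.homogenise n \<alpha> (map (\<lambda>x. x) (tail_prods HG (gs @ [g])))"
    using gs g sub[of gs] H.subset
    by (auto simp: shapiro_cocycle_def tail_prods_HG big.homogenise_tail_prods)
qed (use H.subset in auto)

end

text \<open>\<pi> enters through its equivariance under right multiplication by \<open>H\<close>;
  \<open>transversal_projection\<close> supplies this for the projection along a
  transversal.\<close>

locale shapiro_projection = shapiro_setup G H U act
  for G :: "('g, 'r) monoid_scheme" and H :: "'g set"
    and U :: "('u, 's) monoid_scheme" and act :: "'u \<Rightarrow> 'g \<Rightarrow> 'u" +
  fixes \<pi> :: "'g \<Rightarrow> 'g"
  assumes \<pi>_closed: "g \<in> carrier G \<Longrightarrow> \<pi> g \<in> H"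
    and \<pi>_equivariant: "\<lbrakk>g \<in> carrier G; h \<in> H\<rbrakk> \<Longrightarrow> \<pi> (g \<otimes>\<^bsub>G\<^esub> h) = \<pi> g \<otimes>\<^bsub>G\<^esub> h"
begin

text \<open>The relations prescribe all tail products of \<open>hs\<close>, and a list is recovered
  from these by quotients and last entry. This yields existence, uniqueness and an explicit value
  for the \<open>THE\<close> in \<open>shapiro_inv_cocycle\<close>.\<close>

lemma tail_relations_iff:
  assumes "set gs \<subseteq> carrier G" "gs \<noteq> []"
  defines "zs \<equiv> map \<pi> (tail_prods G gs)"
  shows "tail_relations G H \<pi> gs hs \<longleftrightarrow> hs = quotients HG zs @ [last zs]"
proof -
  have zs: "set zs \<subseteq> H" "zs \<noteq> []" "length zs = length gs"
    using G.tail_prods_closed[OF assms(1)] \<pi>_closed assms(2) by (auto simp: zs_def)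
  have "tail_relations G H \<pi> gs hs \<longleftrightarrow> hs \<in> tuples H (length gs) \<and> tail_prods HG hs = zs"
    by (auto simp: tail_relations_def zs_def tail_prods_HG nth_tail_prods tuples_iff list_eq_iff_nth_eq)
  also have "\<dots> \<longleftrightarrow> hs = quotients HG zs @ [last zs]"
  proof safe
    assume hs: "hs \<in> tuples H (length gs)" "zs = tail_prods HG hs"
    then have "set hs \<subseteq> carrier HG" "hs \<noteq> []"
      using assms(2) by (auto simp: tuples_iff)
    then show "hs = quotients HG (tail_prods HG hs) @ [last (tail_prods HG hs)]"
      by (simp add: M.G.quotients_tail_prods M.G.last_tail_prods)
  next
    show "quotients HG zs @ [last zs] \<in> tuples H (length gs)"
      using zs assms(2) M.G.quotients_closed[of zs] last_in_set[OF zs(2)] by (auto simp: tuples_iff)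
    show "tail_prods HG (quotients HG zs @ [last zs]) = zs"
      using zs by (intro M.G.tail_prods_quotients) auto
  qed
  finally show ?thesis .
qed

text \<open>The first n entries of the solution are the quotients of \<open>?zs\<close>, and
  \<open>hs ! n\<close>, counted from 0, is h_{n+1}, the last entry of \<open>?zs\<close>; so the
  formula is the homogenised \<beta> at \<open>?zs\<close>.\<close>

lemma shapiro_inv_cocycle_eval:
  assumes gs: "gs \<in> tuples (carrier G) n" and g: "g \<in> carrier G"
  shows "shapiro_inv_cocycle G H act \<pi> n \<beta> gs g
    = small.homogenise n \<beta> (map \<pi> (tail_prods G (gs @ [g])))"
proof -
  let ?zs = "map \<pi> (tail_prods G (gs @ [g]))"
  have len: "length gs = n" and sub: "set (gs @ [g]) \<subseteq> carrier G"
    using gs g by (auto simp: tuples_iff)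
  have "(THE hs. tail_relations G H \<pi> (gs @ [g]) hs) = quotients HG ?zs @ [last ?zs]"
    using tail_relations_iff[OF sub] by simp
  then show ?thesis
    using gs g len by (simp add: shapiro_inv_cocycle_def small.homogenise_def nth_append Let_def)
qed

sublocale induction: coinduced_pullback G W "coind_act G" HG U act H U act
  "\<lambda>g w. w g" "\<lambda>h u. act u h" \<pi> "shapiro_inv_cocycle G H act \<pi>"
proof unfold_locales
  show \<pi>: "\<pi> \<in> carrier G \<rightarrow> carrier HG"
    using \<pi>_closed by auto
  fix n \<beta> assume \<beta>: "\<beta> \<in> carrier (cochains HG U n)"
  note hom\<beta> = small.homogeneousD[OF small.homogeneous_homogenise[OF \<beta>]]
  have "shapiro_inv_cocycle G H act \<pi> n \<beta> gs \<in> carrier W" if gs: "gs \<in> tuples (carrier G) n" for gs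
  proof -
    have tp: "set (tail_prods G (gs @ [g])) \<subseteq> carrier G" if "g \<in> carrier G" for g
      using gs that by (intro G.tail_prods_closed) (auto simp: tuples_iff)
    then have zs: "set (map \<pi> (tail_prods G (gs @ [g]))) \<subseteq> carrier HG" if "g \<in> carrier G" for g
      using that \<pi>_closed by auto
    \<comment> \<open>Multiplying the final argument by \<open>h\<close> translates all tail
      products, and \<pi> passes the translation on; hence the value at \<open>gs\<close> is
      equivariant in \<open>g\<close>.\<close>
    have "map \<pi> (tail_prods G (gs @ [g \<otimes>\<^bsub>G\<^esub> h]))
        = map (\<lambda>x. x \<otimes>\<^bsub>HG\<^esub> h) (map \<pi> (tail_prods G (gs @ [g])))"
      if "g \<in> carrier G" "h \<in> H" for g h
      using gs that tp[OF that(1)] H.subset \<pi>_equivariant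
      by (subst G.tail_prods_mult_last) (auto simp: tuples_iff)
    then show ?thesis
      using gs hom\<beta>(1,4)[OF zs] H.subset
      by (auto simp: coind_simps PiE_iff shapiro_inv_cocycle_eval)
        (auto simp: shapiro_inv_cocycle_def)
  qed
  then show "shapiro_inv_cocycle G H act \<pi> n \<beta> \<in> tuples (carrier G) n \<rightarrow>\<^sub>E carrier W"
    by (auto simp: shapiro_inv_cocycle_def)
qed (use \<pi>_equivariant shapiro_inv_cocycle_eval in auto)

text \<open>In homogeneous form the composite is the pullback along \<pi> regarded as a self-map of
  \<open>G\<close>.\<close>

lemma inverse_restriction:
  assumes "\<alpha> \<in> cocycles G W (coind_act G) n"
  shows "\<exists>b\<in>coboundaries G W (coind_act G) n.
    shapiro_inv_cocycle G H act \<pi> n (shapiro_cocycle G H n \<alpha>) = b \<otimes>\<^bsub>cochains G W n\<^esub> \<alpha>"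
proof (rule big.pullback_cohomologous[of \<pi>])
  have \<alpha>: "\<alpha> \<in> carrier (cochains G W n)"
    using assms by (simp add: big.cocycles_iff)
  then show "shapiro_inv_cocycle G H act \<pi> n (shapiro_cocycle G H n \<alpha>) \<in> carrier (cochains G W n)"
    by (intro induction.f_cochain restriction.f_cochain)
  fix xs assume xs: "set xs \<subseteq> carrier G"
  then show "big.homogenise n (shapiro_inv_cocycle G H act \<pi> n (shapiro_cocycle G H n \<alpha>)) xs
      = big.homogenise n \<alpha> (map \<pi> xs)"
    using \<alpha> induction.map_\<phi>_closed[OF xs]
    by (simp add: induction.homogenise_f restriction.homogenise_f restriction.f_cochain)
qed (use assms \<pi>_closed \<pi>_equivariant H.subset in auto)

text \<open>The composite is now the pullback along \<pi> on \<open>H\<close>, a left translation,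
  which commutes with right multiplication by \<open>H\<close>.\<close>

lemma restriction_inverse:
  assumes "\<beta> \<in> cocycles HG U act n"
  shows "\<exists>b\<in>coboundaries HG U act n.
    shapiro_cocycle G H n (shapiro_inv_cocycle G H act \<pi> n \<beta>) = b \<otimes>\<^bsub>cochains HG U n\<^esub> \<beta>"
proof (rule small.pullback_cohomologous[of \<pi>])
  have \<beta>: "\<beta> \<in> carrier (cochains HG U n)"
    using assms by (simp add: small.cocycles_iff)
  then show "shapiro_cocycle G H n (shapiro_inv_cocycle G H act \<pi> n \<beta>) \<in> carrier (cochains HG U n)"
    by (intro induction.f_cochain restriction.f_cochain)
  fix xs assume xs: "set xs \<subseteq> carrier HG"
  then show "small.homogenise n (shapiro_cocycle G H n (shapiro_inv_cocycle G H act \<pi> n \<beta>)) xs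
      = small.homogenise n \<beta> (map \<pi> xs)"
    using \<beta> restriction.map_\<phi>_closed[OF xs]
    by (simp add: induction.homogenise_f restriction.homogenise_f induction.f_cochain)
qed (use assms \<pi>_closed \<pi>_equivariant H.subset in auto)

end

section \<open>The projection along a transversal\<close>

lemma transversal_projection:
  assumes "group G" "subgroup H G" "left_transversal G H Y"
    and \<pi>: "\<forall>y\<in>Y. \<forall>h\<in>H. \<pi> (y \<otimes>\<^bsub>G\<^esub> h) = h" and g: "g \<in> carrier G"
  shows "\<pi> g \<in> H" "h \<in> H \<Longrightarrow> \<pi> (g \<otimes>\<^bsub>G\<^esub> h) = \<pi> g \<otimes>\<^bsub>G\<^esub> h"
proof -
  interpret G: group G by fact
  interpret H: subgroup H G by fact
  obtain k where k: "k \<in> H" "g \<otimes>\<^bsub>G\<^esub> k \<in> Y"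
    using assms(3) g by (auto simp: left_transversal_def l_coset_def)
  \<comment> \<open>\<open>g k\<close> is the representative of the coset of \<open>g\<close>, so g
    h = (g k)(k^{-1} h) has projection k^{-1} h; h = 1 gives \<pi> g.\<close>
  have *: "\<pi> (g \<otimes>\<^bsub>G\<^esub> h) = inv\<^bsub>G\<^esub> k \<otimes>\<^bsub>G\<^esub> h" if "h \<in> H" for h
  proof -
    have "g \<otimes>\<^bsub>G\<^esub> h = (g \<otimes>\<^bsub>G\<^esub> k) \<otimes>\<^bsub>G\<^esub> (inv\<^bsub>G\<^esub> k \<otimes>\<^bsub>G\<^esub> h)"
      using g k(1) that by (simp add: G.m_assoc G.cancel_mult_inv)
    then show ?thesis using \<pi> k that by simp
  qed
  from *[of "\<one>\<^bsub>G\<^esub>"] have "\<pi> g = inv\<^bsub>G\<^esub> k"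
    using g k(1) by simp
  then show "\<pi> g \<in> H" "h \<in> H \<Longrightarrow> \<pi> (g \<otimes>\<^bsub>G\<^esub> h) = \<pi> g \<otimes>\<^bsub>G\<^esub> h"
    using * k(1) by auto
qed

section \<open>The Shapiro isomorphism and its inverse\<close>

theorem theorem1:
  fixes G :: "('g, 'r) monoid_scheme" and H Y :: "'g set"
    and U :: "('u, 's) monoid_scheme" and act :: "'u \<Rightarrow> 'g \<Rightarrow> 'u"
    and \<pi> :: "'g \<Rightarrow> 'g" and n :: nat
  assumes "group G"
    and "subgroup H G"
    and "right_gmodule (G\<lparr>carrier := H\<rparr>) U act"
    and "left_transversal G H Y"
    and "\<forall>y\<in>Y. \<forall>h\<in>H. \<pi> (y \<otimes>\<^bsub>G\<^esub> h) = h"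
  shows
    "shapiro G H U act n \<in> iso (cohomology G (coind G H U act) (coind_act G) n)
                                (cohomology (G\<lparr>carrier := H\<rparr>) U act n)
     \<and> induced_from G (coind G H U act) (coind_act G) (G\<lparr>carrier := H\<rparr>) U act n
         (shapiro G H U act n) (shapiro_cocycle G H n)
     \<and> (\<forall>gs\<in>tuples (carrier G) (n + 1). \<exists>!hs. tail_relations G H \<pi> gs hs)
     \<and> induced_from (G\<lparr>carrier := H\<rparr>) U act G (coind G H U act) (coind_act G) n
         (inv_into (carrier (cohomology G (coind G H U act) (coind_act G) n)) (shapiro G H U act n))
         (shapiro_inv_cocycle G H act \<pi> n)"
proof -
  interpret shapiro_projection G H U act \<pi>
    using assms transversal_projection[OF assms(1,2,4,5)]
    by (intro shapiro_projection.intro shapiro_setup.intro shapiro_projection_axioms.intro)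
  \<comment> \<open>Unfolding gives the quotients and the coset map of \<open>coset_map_iso\<close>,
    with \<open>f\<close> the Shapiro map and \<open>g\<close> its claimed inverse on cocycles; the
    premises on the two composites are \<open>inverse_restriction\<close> and
    \<open>restriction_inverse\<close>.\<close>
  have iso: "shapiro G H U act n \<in> iso (cohomology G W (coind_act G) n) (cohomology HG U act n)"
    and Z: "\<forall>z\<in>cocycles G W (coind_act G) n. shapiro G H U act n
          (coboundaries G W (coind_act G) n #>\<^bsub>cochains G W n\<^esub> z)
        = coboundaries HG U act n #>\<^bsub>cochains HG U n\<^esub> shapiro_cocycle G H n z"
    and Z': "\<forall>w\<in>cocycles HG U act n.
        inv_into (carrier (cohomology G W (coind_act G) n)) (shapiro G H U act n)
          (coboundaries HG U act n #>\<^bsub>cochains HG U n\<^esub> w)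
        = coboundaries G W (coind_act G) n #>\<^bsub>cochains G W n\<^esub> shapiro_inv_cocycle G H act \<pi> n w"
    unfolding cohomology_def shapiro_def
    by (rule coset_map_iso[OF comm_group_cochains[OF comm_group_coind]
        comm_group_cochains[OF M.A.comm_group_axioms]
        big.coboundaries_subgroup small.coboundaries_subgroup big.cocycles_subgroup
        subgroup.subset[OF small.cocycles_subgroup]
        restriction.f_hom restriction.f_cocycles restriction.f_coboundaries
        induction.f_hom induction.f_cocycles induction.f_coboundaries];
        erule inverse_restriction restriction_inverse)+
  moreover have "\<exists>!hs. tail_relations G H \<pi> gs hs" if "gs \<in> tuples (carrier G) (n + 1)" for gs
  proof -
    have "set gs \<subseteq> carrier G" "gs \<noteq> []"
      using that by (auto simp: tuples_iff)
    then show ?thesis by (simp add: tail_relations_iff)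
  qed
  ultimately show ?thesis
    using restriction.f_cocycles induction.f_cocycles
    by (simp add: induced_from_def cohom_class_def flip: image_subset_iff_funcset)
qed

end
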